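(* A weighted composition operator $C_{w,f}$ on $C_0(\Omega)$ is distributionally chaotic if and only if there exists a sequence $(B_i)_{i \in \mathbb{N}}$ of relatively compact open sets in $\Omega$ such that the following properties hold: (a) There exists a set $D \subset \mathbb{N}$ with $\overline{\mathrm{dens}}(D) = 1$ such that \[ \lim_{n \in D} \|w^{(n)}\|_{f^{-n}(B_i)} = 0 \quad \text{for all } i \in \mathbb{N}. \] (b) There exist $\varepsilon > 0$ and an increasing sequence $(N_k)_{k \in \mathbb{N}}$ of positive integers such that, for each $k \in \mathbb{N}$, there exists $i \in \mathbb{N}$ with \[ \mathrm{card}\{1 \le n \le N_k : \|w^{(n)}\|_{f^{-n}(B_i)} > k\} \ge \varepsilon N_k. \]
   Context: Fix $\mathbb{K} = \mathbb{R}$ or $\mathbb{C}$ and an arbitrary locally compact Hausdorff space $\Omega$. $C_0(\Omega)$ is the Banach space over $\mathbb{K}$ of all continuous maps $\varphi : \Omega \to \mathbb{K}$ vanishing at infinity, with norm $\|\varphi\| = \sup_{x\in\Omega} |\varphi(x)|$. For a bounded map $\varphi : \Omega \to \mathbb{K}$ and $B \subset \Omega$, $\|\varphi\|_B = \sup_{x\in B}|\varphi(x)|$, with $\|\varphi\|_\varnothing = 0$. A weighted composition operator on $C_0(\Omega)$ is the map $C_{w,f}(\varphi) = (\varphi\circ f)\cdot w$, where $w : \Omega \to \mathbb{K}$ is continuous and bounded, $f : \Omega \to \Omega$ is continuous, and the set $\{x \in \Omega : f(x) \in K \text{ and } |w(x)| \ge \varepsilon\}$ is compact for every $\varepsilon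 > 0$ and every compact $K \subset \Omega$; these conditions make $C_{w,f}$ a well-defined bounded linear operator on $C_0(\Omega)$. Put $w^{(1)} = w$ and $w^{(n)} = (w\circ f^{n-1})\cdots(w\circ f)\cdot w$ for $n \ge 2$; $\mathbb{N} = \{1,2,\ldots\}$. For $D \subset \mathbb{N}$, $\underline{\mathrm{dens}}(D) = \liminf_{n\to\infty} \frac{\mathrm{card}(D\cap[1,n])}{n}$ and $\overline{\mathrm{dens}}(D) = \limsup_{n\to\infty} \frac{\mathrm{card}(D\cap[1,n])}{n}$. $\lim_{n\in D}$ denotes the limit as $n \to \infty$ along $n \in D$. A map $g : M \to M$ on a metric space $(M,d)$ is distributionally chaotic if there exist an uncountable set $\Gamma \subset M$ and $\varepsilon > 0$ such that for each pair $(x,y)$ of distinct points of $\Gamma$: $\underline{\mathrm{dens}}\{n \in \mathbb{N} : d(g^n(x),g^n(y)) < \varepsilon\} = 0$ and $\overline{\mathrm{dens}}\{n \in \mathbb{N} : d(g^n(x),g^n(y)) < \tau\} = 1$ for all $\tau > 0$. *)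

theory Defs
  imports "HOL-Analysis.Analysis"
begin

text \<open>
  The scalar field ranges over the sort \<open>{real_normed_field, euclidean_space}\<close>. Both
  \<open>real\<close> and \<open>complex\<close> are instances, and up to an isometric isomorphism of real
  algebras they are the only ones: a finite-dimensional commutative real division algebra is
  the reals or the complex numbers, and the norm is multiplicative.

  A locally compact Hausdorff space is a type of class \<open>t2_space\<close> whose topology
  \<open>euclidean\<close> (the library's name for the topology given by the type class) is
  locally compact.
\<close>


subsection \<open>The space of continuous functions vanishing at infinity\<close>

text \<open>
  A continuous function vanishing at infinity is bounded, so nothing is lost by working inside
  the library type of bounded continuous functions, whose \<open>dist\<close> and \<open>norm\<close> are those
  of the supremum norm; see \<open>C0I\<close> and \<open>norm_bcontfun_def\<close>.
\<close>

definition vanishes_at_infinity :: "('a::topological_space \<Rightarrow> 'k::real_normed_vector) \<Rightarrow> bool" where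
  "vanishes_at_infinity \<phi> \<longleftrightarrow> (\<forall>e>0. \<exists>K. compact K \<and> (\<forall>x. x \<notin> K \<longrightarrow> norm (\<phi> x) < e))"

definition C0 :: "('a::topological_space \<Rightarrow>\<^sub>C 'k::real_normed_vector) set" where
  "C0 = {\<phi>. vanishes_at_infinity (apply_bcontfun \<phi>)}"

lemma C0I:
  fixes \<phi> :: "'a::topological_space \<Rightarrow> 'k::real_normed_vector"
  assumes "continuous_on UNIV \<phi>" and "vanishes_at_infinity \<phi>"
  shows "Bcontfun \<phi> \<in> C0" and "apply_bcontfun (Bcontfun \<phi>) = \<phi>"
proof -
  obtain K where K: "compact K" "\<And>x. x \<notin> K \<Longrightarrow> norm (\<phi> x) < 1"
    using assms(2) unfolding vanishes_at_infinity_def by (meson zero_less_one)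
  have "bounded (\<phi> ` K)"
    using K(1) assms(1) by (intro compact_imp_bounded compact_continuous_image continuous_on_subset[OF assms(1)]) auto
  moreover have "bounded (\<phi> ` (- K))"
    unfolding bounded_iff using K(2) by (intro exI[of _ 1]) (auto intro: less_imp_le)
  moreover have "range \<phi> = \<phi> ` K \<union> \<phi> ` (- K)" by auto
  ultimately have "bounded (range \<phi>)" by simp
  then have "\<phi> \<in> bcontfun" using assms(1) by (simp add: bcontfun_def)
  then show *: "apply_bcontfun (Bcontfun \<phi>) = \<phi>" by (rule Bcontfun_inverse)
  show "Bcontfun \<phi> \<in> C0" unfolding C0_def using * assms(2) by simp
qed


subsection \<open>Weighted composition operators\<close>

definition weighted_comp ::
  "('a::topological_space \<Rightarrow> 'k::real_normed_field) \<Rightarrow> ('a \<Rightarrow> 'a) \<Rightarrow> ('a \<Rightarrow>\<^sub>C 'k) \<Rightarrow> ('a \<Rightarrow>\<^sub>C 'k)" where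
  "weighted_comp w f \<phi> = Bcontfun (\<lambda>x. \<phi> (f x) * w x)"

definition weight_prod :: "('a \<Rightarrow> 'k::comm_monoid_mult) \<Rightarrow> ('a \<Rightarrow> 'a) \<Rightarrow> nat \<Rightarrow> 'a \<Rightarrow> 'k" where
  "weight_prod w f n x = (\<Prod>j<n. w ((f ^^ j) x))"

lemma apply_weighted_comp:
  fixes w :: "'a::topological_space \<Rightarrow> 'k::real_normed_field"
  assumes "continuous_on UNIV w" and "bounded (range w)" and "continuous_on UNIV f"
  shows "apply_bcontfun (weighted_comp w f \<phi>) x = \<phi> (f x) * w x"
proof -
  obtain M where M: "\<And>x. norm (w x) \<le> M"
    using assms(2) by (auto simp: bounded_iff)
  have "norm (\<phi> (f x) * w x) \<le> norm \<phi> * M" for x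
    unfolding norm_mult by (intro mult_mono norm_bounded M) auto
  then have "bounded (range (\<lambda>x. \<phi> (f x) * w x))"
    by (auto simp: bounded_iff)
  moreover have "continuous_on UNIV (\<lambda>x. \<phi> (f x) * w x)"
    using assms by (intro continuous_on_mult continuous_on_compose2[OF continuous_on_apply_bcontfun]) auto
  ultimately show ?thesis
    unfolding weighted_comp_def by (simp add: Bcontfun_inverse bcontfun_def)
qed

lemma weighted_comp_C0:
  fixes w :: "'a::topological_space \<Rightarrow> 'k::real_normed_field"
  assumes w: "continuous_on UNIV w" "bounded (range w)" and f: "continuous_on UNIV f"
    and proper: "\<forall>e>0. \<forall>K. compact K \<longrightarrow> compact {x. f x \<in> K \<and> norm (w x) \<ge> e}"
    and \<phi>: "\<phi> \<in> C0"
  shows "weighted_comp w f \<phi> \<in> C0"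
  unfolding C0_def vanishes_at_infinity_def apply_weighted_comp[OF w f] mem_Collect_eq
proof (intro allI impI)
  fix e :: real assume e: "e > 0"
  obtain M where M: "M > 0" "\<And>x. norm (w x) \<le> M"
    using w(2) by (auto simp: bounded_pos)
  define P where "P = norm \<phi> + 1"
  have P: "P > 0" by (simp add: P_def add_nonneg_pos)
  have P': "norm (\<phi> y) \<le> P" for y
    using norm_bounded[of \<phi> y] by (simp add: P_def)
  obtain K where K: "compact K" "\<And>y. y \<notin> K \<Longrightarrow> norm (\<phi> y) < e / M"
    using \<phi> divide_pos_pos[OF e M(1)] unfolding C0_def vanishes_at_infinity_def by blast
  have "norm (\<phi> (f x) * w x) < e" if "\<not> (f x \<in> K \<and> norm (w x) \<ge> e / P)" for x
  proof (cases "f x \<in> K")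
    case True
    then have "norm (w x) < e / P" using that by simp
    then have "P * norm (w x) < e" using P by (simp add: field_simps)
    moreover have "norm (\<phi> (f x)) * norm (w x) \<le> P * norm (w x)"
      by (intro mult_right_mono P') auto
    ultimately show ?thesis by (simp add: norm_mult)
  next
    case False
    then have "norm (\<phi> (f x)) * M < e" using K(2) M(1) by (simp add: field_simps)
    moreover have "norm (\<phi> (f x)) * norm (w x) \<le> norm (\<phi> (f x)) * M"
      by (intro mult_left_mono M) auto
    ultimately show ?thesis by (simp add: norm_mult)
  qed
  moreover have "compact {x. f x \<in> K \<and> norm (w x) \<ge> e / P}"
    using proper K(1) e P by simp
  ultimately show "\<exists>K. compact K \<and> (\<forall>x. x \<notin> K \<longrightarrow> norm (\<phi> (f x) * w x) < e)"
    by (intro exI[of _ "{x. f x \<in> K \<and> norm (w x) \<ge> e / P}"]) auto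
qed

definition supnorm_on :: "'a set \<Rightarrow> ('a \<Rightarrow> 'k::real_normed_vector) \<Rightarrow> real" where
  "supnorm_on B \<phi> = (if B = {} then 0 else (SUP x\<in>B. norm (\<phi> x)))"


subsection \<open>Densities and distributional chaos\<close>

text \<open>
  The positive integers are the \<open>n :: nat\<close> with \<open>n \<ge> 1\<close>; the value at \<open>n = 0\<close> does not
  influence the limits below.
\<close>

definition lower_dens :: "nat set \<Rightarrow> ereal" where
  "lower_dens D = liminf (\<lambda>n. ereal (real (card (D \<inter> {1..n})) / real n))"

definition upper_dens :: "nat set \<Rightarrow> ereal" where
  "upper_dens D = limsup (\<lambda>n. ereal (real (card (D \<inter> {1..n})) / real n))"

text \<open>
  The metric space is a subset \<open>M\<close> of a metric type, with \<open>g\<close> mapping \<open>M\<close> into itself.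
  For \<open>M = C0\<close> and \<open>g = weighted_comp w f\<close> the latter is \<open>weighted_comp_C0\<close>.
\<close>

definition distributionally_chaotic_on :: "'m::metric_space set \<Rightarrow> ('m \<Rightarrow> 'm) \<Rightarrow> bool" where
  "distributionally_chaotic_on M g \<longleftrightarrow>
    (\<exists>\<Gamma> e. \<Gamma> \<subseteq> M \<and> uncountable \<Gamma> \<and> e > 0 \<and>
      (\<forall>x\<in>\<Gamma>. \<forall>y\<in>\<Gamma>. x \<noteq> y \<longrightarrow>
        lower_dens {n. 1 \<le> n \<and> dist ((g ^^ n) x) ((g ^^ n) y) < e} = 0 \<and>
        (\<forall>t>0. upper_dens {n. 1 \<le> n \<and> dist ((g ^^ n) x) ((g ^^ n) y) < t} = 1)))"

end

theory Submission
  imports Defs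
begin

text \<open>
  Chaos \<open>\<Longrightarrow>\<close> weights: if \<open>\<phi>\<close> is the difference of two points of a scrambled set, the superlevel sets
  \<open>{\<bar>T\<^sup>j \<phi>\<bar> > 1 / m}\<close> work, since some \<open>T\<^sup>j \<phi>\<close> is arbitrarily small while its orbit exceeds a fixed
  bound at most of the times up to some \<open>N\<close>, where the weights must therefore be large.

  Weights \<open>\<Longrightarrow>\<close> chaos: bump functions supported in the sets \<open>B\<^sub>i\<close> lie in the space \<open>X\<close> of those
  \<open>\<phi>\<close> whose orbit tends to \<open>0\<close> along \<open>D\<close>, and some of them have orbits that are large during a fixed
  proportion \<open>\<epsilon>\<close> of the times. A pigeonhole argument on the levels \<open>1, K, K\<^sup>2, \<dots>\<close> of the orbit norms
  raises the proportion from \<open>\<epsilon>\<close> to \<open>1 - \<delta>\<close>, at the price of restarting the orbit at a later time.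
  Hence in the closure of \<open>X\<close> both the vectors with distributionally small and those with
  distributionally unbounded orbits form dense \<open>G\<^sub>\<delta>\<close> sets. By Baire there is a vector of both
  kinds, and the line it spans is scrambled.
\<close>

subsection \<open>Densities\<close>

text \<open>Every quotient is at most 1, so the limsup equals 1 exactly when it is not below 1. The
  open sets of the Baire argument encode this form, which involves no limit and no division.\<close>

lemma upper_dens_eq_1_iff:
  "upper_dens D = 1 \<longleftrightarrow>
    (\<forall>\<delta>>0. \<exists>\<^sub>F n in sequentially. real (card (D \<inter> {1..n})) > (1 - \<delta>) * real n)"
proof -
  let ?X = "\<lambda>n. ereal (real (card (D \<inter> {1..n})) / real n)"
  have le: "upper_dens D \<le> 1"
    unfolding upper_dens_def
  proof (intro Limsup_bounded always_eventually allI)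
    fix n
    have "card (D \<inter> {1..n}) \<le> card {1..n}" by (intro card_mono) auto
    then show "?X n \<le> 1" by (cases "n = 0") (simp_all add: divide_le_eq_1 flip: one_ereal_def)
  qed
  show ?thesis
  proof (intro iffI allI impI)
    fix \<delta> :: real assume D: "upper_dens D = 1" and "\<delta> > 0"
    show "\<exists>\<^sub>F n in sequentially. real (card (D \<inter> {1..n})) > (1 - \<delta>) * real n"
    proof (rule ccontr)
      assume "\<not> ?thesis"
      then have "\<forall>\<^sub>F n in sequentially. real (card (D \<inter> {1..n})) \<le> (1 - \<delta>) * real n"
        by (simp add: not_frequently not_less)
      then have "\<forall>\<^sub>F n in sequentially. ?X n \<le> ereal (1 - \<delta>)"
        using eventually_gt_at_top[of 0]
        by eventually_elim (simp add: field_simps)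
      then have "upper_dens D \<le> ereal (1 - \<delta>)"
        unfolding upper_dens_def by (rule Limsup_bounded)
      then show False using D \<open>\<delta> > 0\<close> by (simp add: one_ereal_def)
    qed
  next
    assume R: "\<forall>\<delta>>0. \<exists>\<^sub>F n in sequentially. real (card (D \<inter> {1..n})) > (1 - \<delta>) * real n"
    show "upper_dens D = 1"
    proof (rule ccontr)
      assume "upper_dens D \<noteq> 1"
      then have "upper_dens D < 1" using le by simp
      then obtain r where r: "upper_dens D < ereal r" "ereal r < 1" using ereal_dense2 by blast
      have "\<forall>\<^sub>F n in sequentially. ?X n < ereal r"
        using r(1) unfolding upper_dens_def by (rule Limsup_lessD)
      then have "\<forall>\<^sub>F n in sequentially. real (card (D \<inter> {1..n})) \<le> r * real n"
        using eventually_gt_at_top[of 0]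
        by eventually_elim (simp add: field_simps)
      moreover have "\<exists>\<^sub>F n in sequentially. real (card (D \<inter> {1..n})) > r * real n"
        using R[rule_format, of "1 - r"] r(2) by simp
      ultimately show False by (simp add: frequently_def not_less)
    qed
  qed
qed

text \<open>Dually, the quotients are nonnegative, so only a positive liminf has to be
  excluded.\<close>

lemma lower_dens_eq_0_iff:
  "lower_dens D = 0 \<longleftrightarrow>
    (\<forall>\<delta>>0. \<exists>\<^sub>F n in sequentially. real (card (D \<inter> {1..n})) < \<delta> * real n)"
proof -
  let ?X = "\<lambda>n. ereal (real (card (D \<inter> {1..n})) / real n)"
  have ge: "lower_dens D \<ge> 0"
    unfolding lower_dens_def by (intro Liminf_bounded always_eventually allI) simp
  show ?thesis
  proof (intro iffI allI impI)
    fix \<delta> :: real assume D: "lower_dens D = 0" and "\<delta> > 0"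
    show "\<exists>\<^sub>F n in sequentially. real (card (D \<inter> {1..n})) < \<delta> * real n"
    proof (rule ccontr)
      assume "\<not> ?thesis"
      then have "\<forall>\<^sub>F n in sequentially. real (card (D \<inter> {1..n})) \<ge> \<delta> * real n"
        by (simp add: not_frequently not_less)
      then have "\<forall>\<^sub>F n in sequentially. ereal \<delta> \<le> ?X n"
        using eventually_gt_at_top[of 0]
        by eventually_elim (simp add: field_simps)
      then have "ereal \<delta> \<le> lower_dens D"
        unfolding lower_dens_def by (rule Liminf_bounded)
      then show False using D \<open>\<delta> > 0\<close> by simp
    qed
  next
    assume R: "\<forall>\<delta>>0. \<exists>\<^sub>F n in sequentially. real (card (D \<inter> {1..n})) < \<delta> * real n"
    show "lower_dens D = 0"
    proof (rule ccontr)
      assume "lower_dens D \<noteq> 0"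
      then have "0 < lower_dens D" using ge by simp
      then obtain r where r: "0 < ereal r" "ereal r < lower_dens D" using ereal_dense2 by blast
      have "\<forall>\<^sub>F n in sequentially. ereal r < ?X n"
        using r(2) unfolding lower_dens_def by (rule less_LiminfD)
      then have "\<forall>\<^sub>F n in sequentially. \<not> real (card (D \<inter> {1..n})) < r * real n"
        using eventually_gt_at_top[of 0]
        by eventually_elim (simp add: field_simps)
      moreover have "\<exists>\<^sub>F n in sequentially. real (card (D \<inter> {1..n})) < r * real n"
        using R[rule_format, of r] r(1) by simp
      ultimately show False by (simp add: frequently_def)
    qed
  qed
qed

text \<open>If the inclusion fails only below \<open>m\<close>, the counts lose at most
  \<open>m\<close>, which for large \<open>n\<close> is at most half of
  \<open>\<delta> * n\<close>.\<close>

lemma upper_dens_eq_1_eventually_mono: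
  assumes "upper_dens D = 1" and "\<forall>\<^sub>F n in sequentially. n \<in> D \<longrightarrow> n \<in> E"
  shows "upper_dens E = 1"
  unfolding upper_dens_eq_1_iff
proof (intro allI impI)
  fix \<delta> :: real assume "\<delta> > 0"
  obtain m where m: "\<And>n. n \<ge> m \<Longrightarrow> n \<in> D \<Longrightarrow> n \<in> E"
    using assms(2) unfolding eventually_sequentially by blast
  have card: "card (D \<inter> {1..n}) \<le> card (E \<inter> {1..n}) + m" for n
  proof -
    have "card (D \<inter> {1..n}) \<le> card ((E \<inter> {1..n}) \<union> {..<m})"
      using m by (intro card_mono) (auto simp: not_less)
    also have "\<dots> \<le> card (E \<inter> {1..n}) + m"
      by (metis card_Un_le card_lessThan)
    finally show ?thesis .
  qed
  have "\<exists>\<^sub>F n in sequentially. real (card (D \<inter> {1..n})) > (1 - \<delta>/2) * real n"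
    using assms(1) \<open>\<delta> > 0\<close> unfolding upper_dens_eq_1_iff by simp
  moreover have "\<forall>\<^sub>F n in sequentially. real n \<ge> 2 * m / \<delta>"
    using filterlim_real_sequentially unfolding filterlim_at_top by blast
  ultimately have "\<exists>\<^sub>F n in sequentially. real (card (D \<inter> {1..n})) > (1 - \<delta>/2) * real n \<and> real n \<ge> 2 * m / \<delta>"
    by (rule frequently_eventually_frequently)
  then show "\<exists>\<^sub>F n in sequentially. real (card (E \<inter> {1..n})) > (1 - \<delta>) * real n"
  proof (rule frequently_elim1)
    fix n assume n: "real (card (D \<inter> {1..n})) > (1 - \<delta>/2) * real n \<and> real n \<ge> 2 * m / \<delta>"
    have "real m \<le> \<delta>/2 * real n" using n \<open>\<delta> > 0\<close> by (simp add: field_simps)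
    moreover have "real (card (D \<inter> {1..n})) \<le> real (card (E \<inter> {1..n})) + real m"
      using card[of n] by linarith
    ultimately show "real (card (E \<inter> {1..n})) > (1 - \<delta>) * real n"
      using n by (simp add: algebra_simps)
  qed
qed

text \<open>A diagonal choice: the sets of times with \<open>g n < 1 / (k + 1)\<close> shrink as
  \<open>k\<close> grows, and for suitable lengths each fills almost all of
  \<open>{1..N (Suc k)}\<close>. One set \<open>D\<close> follows them in succession.\<close>

lemma upper_dens_1_obtain_tendsto_0:
  fixes g :: "nat \<Rightarrow> real"
  assumes "\<And>n. g n \<ge> 0" and "\<And>t. t > 0 \<Longrightarrow> upper_dens {n. 1 \<le> n \<and> g n < t} = 1"
  obtains D where "D \<subseteq> {1..}" "upper_dens D = 1" "(g \<longlongrightarrow> 0) (inf sequentially (principal D))"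
proof -
  let ?G = "\<lambda>k. {n. 1 \<le> n \<and> g n < 1 / real (Suc k)}"
  have "\<exists>N. \<forall>k. True \<and> N k < N (Suc k) \<and>
      real (card (?G k \<inter> {1..N (Suc k)})) > (1 - 1 / real (Suc k)) * real (N (Suc k))"
  proof (rule dependent_nat_choice)
    fix M k
    have "upper_dens (?G k) = 1" by (intro assms(2)) simp
    then have "\<exists>\<^sub>F n in sequentially. real (card (?G k \<inter> {1..n})) > (1 - 1 / real (Suc k)) * real n"
      unfolding upper_dens_eq_1_iff by simp
    then show "\<exists>N. True \<and> M < N \<and> real (card (?G k \<inter> {1..N})) > (1 - 1 / real (Suc k)) * real N"
      unfolding frequently_sequentially by (metis Suc_le_lessD)
  qed simp
  then obtain N where N: "\<And>k. N k < N (Suc k)"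
    and card: "\<And>k. real (card (?G k \<inter> {1..N (Suc k)})) > (1 - 1 / real (Suc k)) * real (N (Suc k))"
    by blast
  have mono: "strict_mono N" using N by (simp add: strict_mono_Suc_iff)
  \<comment> \<open>Threshold \<open>k\<close> is imposed only after \<open>N k\<close>. Up to
    \<open>N (Suc k)\<close> only the thresholds 0 to \<open>k\<close> are active, and the last is
    the strictest, so \<open>?G k\<close> lies in \<open>D\<close> there.\<close>
  define D where "D = {n. 1 \<le> n \<and> (\<forall>k. N k < n \<longrightarrow> g n < 1 / real (Suc k))}"
  have sub: "?G k \<inter> {1..N (Suc k)} \<subseteq> D \<inter> {1..N (Suc k)}" for k
  proof
    fix n assume n: "n \<in> ?G k \<inter> {1..N (Suc k)}"
    have "g n < 1 / real (Suc j)" if "N j < n" for j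
    proof -
      have "N j < N (Suc k)" using that n by simp
      then have "j < Suc k" using mono by (simp add: strict_mono_less)
      then have "1 / real (Suc k) \<le> 1 / real (Suc j)" by (simp add: field_simps)
      then show ?thesis using n by simp
    qed
    then show "n \<in> D \<inter> {1..N (Suc k)}" using n by (simp add: D_def)
  qed
  show ?thesis
  proof
    show "D \<subseteq> {1..}" by (auto simp: D_def)
    show "upper_dens D = 1"
      unfolding upper_dens_eq_1_iff frequently_sequentially
    proof (intro allI impI)
      fix \<delta> :: real and m :: nat assume "\<delta> > 0"
      obtain k0 where k0: "inverse (real (Suc k0)) < \<delta>" using reals_Archimedean[OF \<open>\<delta> > 0\<close>] by blast
      define k where "k = max k0 m"
      have "1 / real (Suc k) \<le> 1 / real (Suc k0)" by (simp add: k_def field_simps)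
      then have "1 - \<delta> \<le> 1 - 1 / real (Suc k)" using k0 by (simp add: inverse_eq_divide)
      then have "(1 - \<delta>) * real (N (Suc k)) \<le> (1 - 1 / real (Suc k)) * real (N (Suc k))"
        by (rule mult_right_mono) simp
      also have "\<dots> < real (card (?G k \<inter> {1..N (Suc k)}))" by (rule card)
      also have "\<dots> \<le> real (card (D \<inter> {1..N (Suc k)}))"
        using sub by (intro of_nat_mono card_mono) auto
      finally have "(1 - \<delta>) * real (N (Suc k)) < real (card (D \<inter> {1..N (Suc k)}))" .
      moreover have "m \<le> N (Suc k)"
        using seq_suble[OF mono, of "Suc k"] by (simp add: k_def)
      ultimately show "\<exists>n\<ge>m. (1 - \<delta>) * real n < real (card (D \<inter> {1..n}))" by blast
    qed
    show "(g \<longlongrightarrow> 0) (inf sequentially (principal D))"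
    proof (rule tendstoI)
      fix e :: real assume "e > 0"
      obtain k where k: "inverse (real (Suc k)) < e" using reals_Archimedean[OF \<open>e > 0\<close>] by blast
      have "\<forall>\<^sub>F n in sequentially. n \<in> D \<longrightarrow> dist (g n) 0 < e"
        using eventually_gt_at_top[of "N k"]
      proof eventually_elim
        case (elim n)
        show ?case
        proof
          assume "n \<in> D"
          then have "g n < 1 / real (Suc k)" using elim by (simp add: D_def)
          then show "dist (g n) 0 < e" using k assms(1)[of n] by (simp add: inverse_eq_divide)
        qed
      qed
      then show "\<forall>\<^sub>F n in inf sequentially (principal D). dist (g n) 0 < e"
        by (simp add: eventually_inf_principal)
    qed
  qed
qed

section \<open>Counting the times at which a real sequence exceeds a level\<close>

text \<open>
  Splitting at the last time before \<open>N\<close> at which the level is at most \<open>s\<close> shows that, if the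
  conclusion of \<open>dense_excursion\<close> below fails, raising the level from \<open>s\<close> to \<open>K * s\<close>
  loses a fixed proportion of the times.
\<close>
lemma card_level_le:
  fixes a :: "nat \<Rightarrow> real"
  assumes "s \<le> s'" and "a 0 \<le> s" and "q \<ge> 0"
    and sparse: "\<And>m l. a m \<le> s \<Longrightarrow> l \<ge> 1 \<Longrightarrow> real (card {n\<in>{1..l}. a (m + n) > s'}) \<le> q * real l"
  shows "real (card {n\<in>{1..N}. a n > s'}) \<le> q * real (card {n\<in>{1..N}. a n > s})"
proof (induction N rule: less_induct)
  case (less N)
  \<comment> \<open>The last time up to \<open>N\<close> with level at most \<open>s\<close>; it
    exists because \<open>a 0 \<le> s\<close>. The block after it starts from such a level, so
    \<open>sparse\<close> applies to it.\<close>
  define m where "m = Max {m. m \<le> N \<and> a m \<le> s}"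
  have "m \<in> {m. m \<le> N \<and> a m \<le> s}"
    unfolding m_def by (rule Max_in) (use assms(2) in auto)
  then have m: "m \<le> N" "a m \<le> s" by auto
  have above: "a n > s" if "m < n" "n \<le> N" for n
  proof (rule ccontr)
    assume "\<not> a n > s"
    then have "n \<le> m" unfolding m_def using that by (intro Max_ge) auto
    then show False using that by simp
  qed
  have split: "card {n\<in>{1..N}. a n > t} = card {n\<in>{1..m}. a n > t} + card {n\<in>{m<..N}. a n > t}" for t
    using m(1) by (subst card_Un_disjoint[symmetric]) (auto intro!: arg_cong[where f = card])
  have shift: "card {n\<in>{m<..N}. a n > t} = card {n\<in>{1..N - m}. a (m + n) > t}" for t
    by (rule bij_betw_same_card[of "\<lambda>n. n - m"], rule bij_betwI[of _ _ _ "\<lambda>n. m + n"]) auto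
  have first: "real (card {n\<in>{1..m}. a n > s'}) \<le> q * real (card {n\<in>{1..m}. a n > s})"
  \<comment> \<open>Time \<open>m\<close> itself is not counted at any level
    \<open>t \<ge> s\<close>, so the first block shrinks to \<open>{1..m - 1}\<close>. The induction
    hypothesis therefore applies even when \<open>m = N\<close>.\<close>
  proof (cases "m = 0")
    case False
    then obtain j where j: "m = Suc j" using not0_implies_Suc by blast
    have "{n\<in>{1..m}. a n > t} = {n\<in>{1..j}. a n > t}" if "t \<ge> s" for t
      using m(2) that by (auto simp: j le_Suc_eq)
    then show ?thesis using less.IH[of j] m(1) j assms(1) by simp
  qed simp
  have "{n\<in>{m<..N}. a n > s} = {m<..N}" using above by auto
  then have second: "card {n\<in>{m<..N}. a n > s} = N - m" by simp
  have "real (card {n\<in>{m<..N}. a n > s'}) \<le> q * real (N - m)"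
  proof (cases "m = N")
    case False
    then show ?thesis unfolding shift by (intro sparse m(2)) (use m(1) in simp)
  qed simp
  then show ?case using first unfolding split second by (simp add: algebra_simps)
qed

text \<open>Without such an excursion, \<open>card_level_le\<close> shows that each passage from
  level \<open>K ^ i\<close> to \<open>K ^ Suc i\<close> keeps at most the fraction
  \<open>1 - \<delta>\<close> of the times, and after \<open>r\<close> passages fewer than
  \<open>\<epsilon> * N\<close> are left. The bound \<open>R = K ^ r\<close> is fixed before the
  sequence \<open>a\<close> and the length \<open>N\<close>.\<close>

lemma dense_excursion:
  fixes \<epsilon> \<delta> K :: real
  assumes "\<epsilon> > 0" "\<delta> > 0" "\<delta> < 1" "K \<ge> 1"
  shows "\<exists>R. \<forall>a N. a 0 \<le> 1 \<longrightarrow> N \<ge> 1 \<longrightarrow> real (card {n\<in>{1..N}. a n > R}) \<ge> \<epsilon> * real N \<longrightarrow>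
    (\<exists>m l s. l \<ge> (1::nat) \<and> s \<ge> 1 \<and> a m \<le> s \<and>
      real (card {n\<in>{1..l}. a (m + n) > K * s}) > (1 - \<delta>) * real l)"
proof -
  obtain r where r: "(1 - \<delta>) ^ r < \<epsilon>" using real_arch_pow_inv[OF \<open>\<epsilon> > 0\<close>, of "1 - \<delta>"] assms(2) by auto
  show ?thesis
  proof (rule exI[of _ "K ^ r"], intro allI impI)
    fix a :: "nat \<Rightarrow> real" and N :: nat
    assume a: "a 0 \<le> 1" and N: "N \<ge> 1" and card: "real (card {n\<in>{1..N}. a n > K ^ r}) \<ge> \<epsilon> * real N"
    show "\<exists>m l s. l \<ge> (1::nat) \<and> s \<ge> 1 \<and> a m \<le> s \<and>
        real (card {n\<in>{1..l}. a (m + n) > K * s}) > (1 - \<delta>) * real l"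
    proof (rule ccontr)
      assume neg: "\<not> ?thesis"
      have "real (card {n\<in>{1..N}. a n > K ^ i}) \<le> (1 - \<delta>) ^ i * real N" for i
      proof (induction i)
        case 0
        have "card {n\<in>{1..N}. a n > 1} \<le> card {1..N}" by (intro card_mono) auto
        then show ?case by simp
      next
        case (Suc i)
        have ge1: "K ^ i \<ge> 1" using assms(4) by simp
        have "real (card {n\<in>{1..N}. a n > K * K ^ i}) \<le> (1 - \<delta>) * real (card {n\<in>{1..N}. a n > K ^ i})"
        proof (rule card_level_le)
          show "K ^ i \<le> K * K ^ i" using assms(4) ge1 by simp
          show "a 0 \<le> K ^ i" using a ge1 by linarith
          show "1 - \<delta> \<ge> 0" using assms(3) by simp
        qed (use neg ge1 in \<open>auto simp: not_less\<close>)
        also have "\<dots> \<le> (1 - \<delta>) * ((1 - \<delta>) ^ i * real N)"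
          using Suc.IH assms(3) by (intro mult_left_mono) auto
        finally show ?case by (simp add: mult.assoc)
      qed
      then have "\<epsilon> * real N \<le> (1 - \<delta>) ^ r * real N" using card by (rule order_trans[rotated])
      then show False using r N by simp
    qed
  qed
qed

subsection \<open>Distributional chaos for bounded linear operators\<close>

lemma bounded_linear_funpow:
  fixes T :: "'b::real_normed_vector \<Rightarrow> 'b"
  assumes "bounded_linear T"
  shows "bounded_linear (T ^^ n)"
proof (induction n)
  case 0
  show ?case by (simp add: id_def bounded_linear_ident)
next
  case (Suc n)
  then show ?case using bounded_linear_compose[OF assms Suc] by (simp add: o_def)
qed

text \<open>The real line through \<open>x\<close> is scrambled: the orbits of two multiples differ
  by \<open>\<bar>c - d\<bar>\<close> times the orbit of \<open>x\<close>. As the hypotheses hold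
  for all thresholds, this factor is harmless and the bound 1 serves all pairs.\<close>

lemma distributionally_chaotic_on_if_irregular_vector:
  fixes T :: "'b::real_normed_vector \<Rightarrow> 'b"
  assumes T: "bounded_linear T" and S: "subspace S" and x: "x \<in> S"
    and large: "\<And>R. R > 0 \<Longrightarrow> lower_dens {n. 1 \<le> n \<and> norm ((T ^^ n) x) < R} = 0"
    and small: "\<And>t. t > 0 \<Longrightarrow> upper_dens {n. 1 \<le> n \<and> norm ((T ^^ n) x) < t} = 1"
  shows "distributionally_chaotic_on S T"
proof -
  have "x \<noteq> 0"
  proof
    assume "x = 0"
    then have "norm ((T ^^ n) x) = 0" for n
      using bounded_linear.linear[OF bounded_linear_funpow[OF T]] by (simp add: linear_0)
    then have "lower_dens {n. 1 \<le> n} = 0" using large[of 1] by simp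
    then have "\<exists>\<^sub>F N in sequentially. real (card ({n. 1 \<le> n} \<inter> {1..N})) < 1 * real N"
      unfolding lower_dens_eq_0_iff using zero_less_one by blast
    moreover have "{n. 1 \<le> n} \<inter> {1..N} = {1..N}" for N :: nat by auto
    ultimately have "\<exists>\<^sub>F N in sequentially. real N < real N" by simp
    then show False by simp
  qed
  let ?\<Gamma> = "range (\<lambda>c::real. c *\<^sub>R x)"
  have "inj (\<lambda>c::real. c *\<^sub>R x)" using \<open>x \<noteq> 0\<close> by (simp add: inj_def)
  then have unc: "uncountable ?\<Gamma>" using uncountable_UNIV_real countable_image_inj_eq by blast
  have dist: "dist ((T ^^ n) (c *\<^sub>R x)) ((T ^^ n) (d *\<^sub>R x)) = \<bar>c - d\<bar> * norm ((T ^^ n) x)" for c d n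
  proof -
    have "(T ^^ n) (c *\<^sub>R x) - (T ^^ n) (d *\<^sub>R x) = (c - d) *\<^sub>R (T ^^ n) x"
      using bounded_linear.linear[OF bounded_linear_funpow[OF T]]
      by (simp add: linear_scale algebra_simps)
    then show ?thesis by (simp add: dist_norm)
  qed
  have set: "{n. 1 \<le> n \<and> dist ((T ^^ n) (c *\<^sub>R x)) ((T ^^ n) (d *\<^sub>R x)) < t} =
      {n. 1 \<le> n \<and> norm ((T ^^ n) x) < t / \<bar>c - d\<bar>}" if "c \<noteq> d" for c d t
    unfolding dist using that by (auto simp: field_simps)
  show ?thesis
    unfolding distributionally_chaotic_on_def
  proof (intro exI[of _ ?\<Gamma>] exI[of _ 1] conjI ballI impI allI)
    show "?\<Gamma> \<subseteq> S" using S x by (auto intro: subspace_scale)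
    fix u v assume "u \<in> ?\<Gamma>" "v \<in> ?\<Gamma>" "u \<noteq> v"
    then obtain c d where cd: "u = c *\<^sub>R x" "v = d *\<^sub>R x" "c \<noteq> d" by blast
    show "lower_dens {n. 1 \<le> n \<and> dist ((T ^^ n) u) ((T ^^ n) v) < 1} = 0"
      unfolding cd set[OF cd(3)] using cd(3) by (intro large) simp
    fix t :: real assume "t > 0"
    then show "upper_dens {n. 1 \<le> n \<and> dist ((T ^^ n) u) ((T ^^ n) v) < t} = 1"
      unfolding cd set[OF cd(3)] using cd(3) by (intro small) simp
  qed (use unc in simp_all)
qed

text \<open>
  Perturb \<open>x\<close> by \<open>r\<close> different multiples of \<open>z\<close>: at a time when the orbit of \<open>z\<close> is large, at most
  one of the \<open>r\<close> perturbed orbits is small, so one of them is large at most times.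
\<close>
lemma perturbation_large_orbit:
  fixes T :: "'b::real_normed_vector \<Rightarrow> 'b" and \<eta> R \<delta> :: real
  assumes T: "bounded_linear T" and "\<eta> > 0" "R > 0" "\<delta> > 0"
  shows "\<exists>K\<ge>1. \<forall>z l x. norm z \<le> 1 \<longrightarrow> l \<ge> (1::nat) \<longrightarrow>
      real (card {n\<in>{1..l}. norm ((T ^^ n) z) > K}) > (1 - \<delta> / 2) * real l \<longrightarrow>
      (\<exists>c. \<bar>c\<bar> \<le> \<eta> \<and> real (card {n\<in>{1..l}. norm ((T ^^ n) (x + c *\<^sub>R z)) > R}) > (1 - \<delta>) * real l)"
proof -
  \<comment> \<open>With more than \<open>2 / \<delta>\<close> perturbations, the smallest of the
    \<open>r\<close> disjoint bad sets has at most \<open>l / r\<close> elements, which is below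
    \<open>\<delta> / 2 * l\<close>.\<close>
  obtain r :: nat where r: "real r > 2 / \<delta>" using reals_Archimedean2 by blast
  then have r0: "r > 0" using \<open>\<delta> > 0\<close> by (intro gr0I) (simp add: not_less)
  show ?thesis
  \<comment> \<open>Consecutive perturbations are spaced by \<open>\<eta> / r\<close>, so whenever
    the orbit of \<open>z\<close> exceeds this constant their orbits are more than
    \<open>2 * R\<close> apart and cannot both have norm at most \<open>R\<close>.\<close>
  proof (rule exI[of _ "max 1 (2 * R * real r / \<eta>)"], intro conjI allI impI)
    fix z x :: 'b and l
    assume l: "l \<ge> (1::nat)" and z: "norm z \<le> 1"
    define G where "G = {n\<in>{1..l}. norm ((T ^^ n) z) > max 1 (2 * R * real r / \<eta>)}"
    assume "real (card {n\<in>{1..l}. norm ((T ^^ n) z) > max 1 (2 * R * real r / \<eta>)}) > (1 - \<delta> / 2) * real l"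
    then have G: "real (card G) > (1 - \<delta> / 2) * real l" by (simp add: G_def)
    have "G \<subseteq> {1..l}" by (auto simp: G_def)
    then have fin: "finite G" "card G \<le> l"
      using card_mono[of "{1..l}" G] by (auto intro: finite_subset)
    define y where "y = (\<lambda>t::nat. x + (\<eta> * real t / real r) *\<^sub>R z)"
    define Bad where "Bad = (\<lambda>t. {n\<in>G. norm ((T ^^ n) (y t)) \<le> R})"
    have disj: "Bad s \<inter> Bad t = {}" if "s < t" for s t
    proof (rule ccontr)
      assume "Bad s \<inter> Bad t \<noteq> {}"
      then obtain n where n: "n \<in> G" "norm ((T ^^ n) (y s)) \<le> R" "norm ((T ^^ n) (y t)) \<le> R"
        by (auto simp: Bad_def)
      interpret L: linear "T ^^ n" by (rule bounded_linear.linear[OF bounded_linear_funpow[OF T]])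
      have "y t - y s = (\<eta> * (real t - real s) / real r) *\<^sub>R z"
        by (simp add: y_def algebra_simps diff_divide_distrib)
      then have "(T ^^ n) (y t) - (T ^^ n) (y s) = (\<eta> * (real t - real s) / real r) *\<^sub>R (T ^^ n) z"
        by (metis L.diff L.scale)
      then have "(\<eta> * (real t - real s) / real r) * norm ((T ^^ n) z) = norm ((T ^^ n) (y t) - (T ^^ n) (y s))"
        using that \<open>\<eta> > 0\<close> by simp
      also have "\<dots> \<le> R + R" using n(2,3) by (intro order_trans[OF norm_triangle_ineq4] add_mono)
      finally have "(\<eta> * (real t - real s) / real r) * norm ((T ^^ n) z) \<le> 2 * R" by simp
      moreover have "2 * R < (\<eta> / real r) * norm ((T ^^ n) z)"
        using n(1) \<open>\<eta> > 0\<close> r0 by (simp add: G_def field_simps)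
      moreover have "(\<eta> / real r) * norm ((T ^^ n) z) \<le> (\<eta> * (real t - real s) / real r) * norm ((T ^^ n) z)"
        using mult_left_mono[of 1 "real t - real s" \<eta>] that \<open>\<eta> > 0\<close>
        by (intro mult_right_mono divide_right_mono) auto
      ultimately show False by linarith
    qed
    have "\<exists>t\<in>{1..r}. real (card (Bad t)) * real r \<le> real l"
    proof (rule ccontr)
      assume "\<not> ?thesis"
      then have "real l / real r < real (card (Bad t))" if "t \<in> {1..r}" for t
        using that r0 by (auto simp: not_le field_simps)
      then have "(\<Sum>t\<in>{1..r}. real l / real r) < (\<Sum>t\<in>{1..r}. real (card (Bad t)))"
        using r0 by (intro sum_strict_mono) auto
      moreover have "(\<Sum>t\<in>{1..r}. card (Bad t)) = card (\<Union>t\<in>{1..r}. Bad t)"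
      proof (rule card_UN_disjoint[symmetric])
        show "\<forall>i\<in>{1..r}. \<forall>j\<in>{1..r}. i \<noteq> j \<longrightarrow> Bad i \<inter> Bad j = {}"
          using disj by (metis Int_commute linorder_neqE_nat)
      qed (use fin in \<open>auto simp: Bad_def\<close>)
      moreover have "card (\<Union>t\<in>{1..r}. Bad t) \<le> card G"
        using fin by (intro card_mono) (auto simp: Bad_def)
      ultimately show False using fin(2) r0 by (simp flip: of_nat_sum)
    qed
    then obtain t where t: "t \<in> {1..r}" "real (card (Bad t)) * real r \<le> real l" by blast
    have "real (card (Bad t)) \<le> \<delta> / 2 * real l"
    proof -
      have "real (card (Bad t)) \<le> real l / real r" using t(2) r0 by (simp add: field_simps)
      also have "\<dots> = real l * (1 / real r)" by simp
      also have "\<dots> \<le> real l * (\<delta> / 2)"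
        using r r0 \<open>\<delta> > 0\<close> by (intro mult_left_mono) (auto simp: field_simps)
      finally show ?thesis by (simp add: mult.commute)
    qed
    moreover have "real (card G) - real (card (Bad t)) \<le> real (card {n\<in>{1..l}. norm ((T ^^ n) (y t)) > R})"
    proof -
      have "card G \<le> card (Bad t \<union> {n\<in>{1..l}. norm ((T ^^ n) (y t)) > R})"
        using fin(1) by (intro card_mono) (auto simp: Bad_def G_def)
      also have "\<dots> \<le> card (Bad t) + card {n\<in>{1..l}. norm ((T ^^ n) (y t)) > R}" by (rule card_Un_le)
      finally show ?thesis by linarith
    qed
    ultimately have "real (card {n\<in>{1..l}. norm ((T ^^ n) (y t)) > R}) > (1 - \<delta>) * real l"
      using G by (simp add: algebra_simps)
    moreover have "\<bar>\<eta> * real t / real r\<bar> \<le> \<eta>"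
      using t(1) r0 \<open>\<eta> > 0\<close> by (simp add: field_simps)
    ultimately show "\<exists>c. \<bar>c\<bar> \<le> \<eta> \<and>
        real (card {n\<in>{1..l}. norm ((T ^^ n) (x + c *\<^sub>R z)) > R}) > (1 - \<delta>) * real l"
      unfolding y_def by blast
  qed simp
qed

section \<open>Topological preliminaries for the Baire argument\<close>

text \<open>The count exceeds \<open>c\<close> iff the conditions hold together on some finite set
  of more than \<open>c\<close> times, which gives a union of finite intersections of open
  sets.\<close>

lemma open_card_greater:
  fixes P :: "nat \<Rightarrow> 'b::topological_space \<Rightarrow> bool"
  assumes "\<And>n. open {x. P n x}"
  shows "open {x. real (card {n\<in>{1..N}. P n x}) > c}"
proof -
  have "{x. real (card {n\<in>{1..N}. P n x}) > c} =
      (\<Union>F\<in>{F. F \<subseteq> {1..N} \<and> real (card F) > c}. \<Inter>n\<in>F. {x. P n x})" (is "?L = ?R")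
  proof
    show "?L \<subseteq> ?R"
    proof
      fix x assume "x \<in> ?L"
      then show "x \<in> ?R" by (intro UN_I[of "{n\<in>{1..N}. P n x}"]) auto
    qed
    show "?R \<subseteq> ?L"
    proof clarsimp
      fix x F assume F: "F \<subseteq> {Suc 0..N}" "c < real (card F)" "\<forall>n\<in>F. P n x"
      then have "card F \<le> card {n\<in>{1..N}. P n x}" by (intro card_mono) auto
      then show "c < real (card {n. Suc 0 \<le> n \<and> n \<le> N \<and> P n x})" using F(2) by simp
    qed
  qed
  moreover have "open ?R"
    using assms by (intro open_UN ballI open_INT) (auto elim: finite_subset)
  ultimately show ?thesis by simp
qed

text \<open>Passes from completeness of a metric type to the abstract topology of a closed subset,
  the form that \<open>Baire_category\<close> takes.\<close>

lemma completely_metrizable_space_closed: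
  fixes S :: "'b::metric_space set"
  assumes "complete (UNIV :: 'b set)" and "closed S"
  shows "completely_metrizable_space (top_of_set S)"
proof -
  have "Met_TC.mcomplete TYPE('b)" using assms(1) by (simp only: mcomplete_iff_complete)
  then have "completely_metrizable_space (Met_TC.mtopology :: 'b topology)"
    by (rule Met_TC.completely_metrizable_space_mtopology)
  then have "completely_metrizable_space (euclidean :: 'b topology)"
    by (simp only: mtopology_is_euclidean)
  moreover have "closedin euclidean S" using assms(2) by (simp only: closed_closedin)
  ultimately show ?thesis by (rule completely_metrizable_space_closedin)
qed

lemma tendsto_norm_zero_dominated:
  assumes "(g \<longlongrightarrow> (0::real)) F" and "\<And>n. norm (h n) \<le> g n"
  shows "((\<lambda>n. norm (h n)) \<longlongrightarrow> 0) F"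
  by (rule tendsto_norm_zero, rule Lim_null_comparison[OF always_eventually assms(1)]) (simp add: assms(2))

text \<open>The space \<open>X\<close> of the proof need not be closed, so the category argument
  runs in its closure \<open>Y\<close>, which stays inside the closed space \<open>S\<close>. The
  proportion \<open>\<epsilon>\<close> is common to all \<open>R\<close>, since
  \<open>dense_excursion\<close> fixes its bound depending on \<open>\<epsilon>\<close>.\<close>

proposition distributionally_chaotic_onI:
  fixes T :: "'b::real_normed_vector \<Rightarrow> 'b"
  assumes T: "bounded_linear T" and comp: "complete (UNIV :: 'b set)"
    and S: "subspace S" "closed S" "T ` S \<subseteq> S"
    and D: "upper_dens D = 1" and "\<epsilon> > 0"
    and ex: "\<And>R::real. \<exists>y\<in>S. norm y \<le> 1 \<and>
        ((\<lambda>n. norm ((T ^^ n) y)) \<longlongrightarrow> 0) (inf sequentially (principal D)) \<and>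
        (\<exists>N\<ge>1. real (card {n\<in>{1..N}. norm ((T ^^ n) y) > R}) \<ge> \<epsilon> * real N)"
  shows "distributionally_chaotic_on S T"
proof -
  let ?F = "inf sequentially (principal D)"
  define X where "X = {y\<in>S. ((\<lambda>n. norm ((T ^^ n) y)) \<longlongrightarrow> 0) ?F}"
  define Y where "Y = closure X"
  have blin: "bounded_linear (T ^^ n)" for n by (rule bounded_linear_funpow[OF T])
  have lin: "linear (T ^^ n)" for n by (rule bounded_linear.linear[OF blin])
  have contT: "continuous_on UNIV (T ^^ n)" for n
    by (rule linear_continuous_on[OF blin])
  have X0: "0 \<in> X" using S(1) by (auto simp: X_def subspace_0 linear_0[OF lin])
  have Xadd: "x + c *\<^sub>R z \<in> X" if "x \<in> X" "z \<in> X" for x z c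
  proof -
    have "((\<lambda>n. norm ((T ^^ n) x) + \<bar>c\<bar> * norm ((T ^^ n) z)) \<longlongrightarrow> 0 + \<bar>c\<bar> * 0) ?F"
      using that by (intro tendsto_intros) (auto simp: X_def)
    moreover have "norm ((T ^^ n) (x + c *\<^sub>R z)) \<le> norm ((T ^^ n) x) + \<bar>c\<bar> * norm ((T ^^ n) z)" for n
      using norm_triangle_ineq[of "(T ^^ n) x" "c *\<^sub>R (T ^^ n) z"]
      by (simp add: linear_add[OF lin] linear_scale[OF lin])
    ultimately have "((\<lambda>n. norm ((T ^^ n) (x + c *\<^sub>R z))) \<longlongrightarrow> 0) ?F"
      by (intro tendsto_norm_zero_dominated) simp_all
    then show ?thesis using that S(1) by (simp add: X_def subspace_add subspace_scale)
  qed
  \<comment> \<open>Iterates commute, so one more application of \<open>T\<close> multiplies the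
    orbit norms by at most a constant and preserves convergence to 0.\<close>
  have XT: "(T ^^ m) x \<in> X" if "x \<in> X" for x m
  proof (induction m)
    case (Suc m)
    obtain C where C: "\<And>v. norm (T v) \<le> norm v * C"
      using bounded_linear.bounded[OF T] by blast
    have "((\<lambda>n. norm ((T ^^ n) ((T ^^ m) x)) * C) \<longlongrightarrow> 0 * C) ?F"
      using Suc by (intro tendsto_intros) (auto simp: X_def)
    moreover have "norm ((T ^^ n) ((T ^^ Suc m) x)) \<le> norm ((T ^^ n) ((T ^^ m) x)) * C" for n
      using C[of "(T ^^ n) ((T ^^ m) x)"] by (simp flip: funpow_swap1)
    ultimately have "((\<lambda>n. norm ((T ^^ n) ((T ^^ Suc m) x))) \<longlongrightarrow> 0) ?F"
      by (intro tendsto_norm_zero_dominated) simp_all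
    then show ?case using Suc S(3) by (auto simp: X_def)
  qed (use that in simp)
  \<comment> \<open>The condition \<open>N \<ge> k\<close> makes the lengths unbounded along the
    intersection of all \<open>V k\<close>, as an upper density requires.\<close>
  define V where "V = (\<lambda>k::nat. {x. \<exists>N\<ge>k. real (card {n\<in>{1..N}. norm ((T ^^ n) x) < 1 / real (Suc k)}) > (1 - 1 / real (Suc k)) * real N})"
  \<comment> \<open>Here the lengths grow by themselves: a value above \<open>k + 1\<close> must
    occur by time \<open>N\<close>, which for a fixed orbit forces \<open>N\<close> to infinity with
    \<open>k\<close>.\<close>
  define U where "U = (\<lambda>k::nat. {x. \<exists>N\<ge>1. real (card {n\<in>{1..N}. norm ((T ^^ n) x) > real (Suc k)}) > (1 - 1 / real (Suc k)) * real N})"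
  have openV: "open (V k)" for k
  proof -
    have "V k = (\<Union>N\<in>{k..}. {x. real (card {n\<in>{1..N}. norm ((T ^^ n) x) < 1 / real (Suc k)}) > (1 - 1 / real (Suc k)) * real N})"
      by (auto simp: V_def)
    also have "open \<dots>"
      by (intro open_UN ballI, rule open_card_greater)
        (intro open_Collect_less continuous_on_norm contT continuous_on_const)
    finally show ?thesis .
  qed
  have openU: "open (U k)" for k
  proof -
    have "U k = (\<Union>N\<in>{1..}. {x. real (card {n\<in>{1..N}. norm ((T ^^ n) x) > real (Suc k)}) > (1 - 1 / real (Suc k)) * real N})"
      by (auto simp: U_def)
    also have "open \<dots>"
      by (intro open_UN ballI, rule open_card_greater)
        (intro open_Collect_less continuous_on_norm contT continuous_on_const)
    finally show ?thesis .
  qed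
  have smallX: "upper_dens {n. 1 \<le> n \<and> norm ((T ^^ n) x) < t} = 1" if "x \<in> X" "t > 0" for x t
  proof (rule upper_dens_eq_1_eventually_mono[OF D])
    have "\<forall>\<^sub>F n in ?F. norm ((T ^^ n) x) < t"
      using that by (auto simp: X_def dest: order_tendstoD)
    then have "\<forall>\<^sub>F n in sequentially. n \<in> D \<longrightarrow> norm ((T ^^ n) x) < t"
      by (simp add: eventually_inf_principal)
    then show "\<forall>\<^sub>F n in sequentially. n \<in> D \<longrightarrow> n \<in> {n. 1 \<le> n \<and> norm ((T ^^ n) x) < t}"
      using eventually_ge_at_top[of 1] by eventually_elim simp
  qed
  have int: "{n. 1 \<le> n \<and> P n} \<inter> {1..N} = {n\<in>{1..N}. P n}" for P and N :: nat by auto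
  have XV: "X \<subseteq> V k" for k
  proof
    fix x assume "x \<in> X"
    then have "\<exists>\<^sub>F N in sequentially. real (card ({n. 1 \<le> n \<and> norm ((T ^^ n) x) < 1 / real (Suc k)} \<inter> {1..N})) > (1 - 1 / real (Suc k)) * real N"
      using smallX[of x "1 / real (Suc k)"] unfolding upper_dens_eq_1_iff by simp
    then show "x \<in> V k" unfolding V_def frequently_sequentially int by simp
  qed
  have XU: "X \<subseteq> closure (X \<inter> U k)" for k
  proof (clarsimp simp: closure_approachable)
    fix x \<eta> assume x: "x \<in> X" and "\<eta> > (0::real)"
    \<comment> \<open>The excursion loses \<open>d / 2\<close> of the times and the perturbation
      another \<open>d / 2\<close>. The order of choices matters: first \<open>K\<close>, then
      \<open>R\<close> depending on \<open>K\<close>, then the vector \<open>y\<close> depending on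
      \<open>R\<close>.\<close>
    define d where "d = 1 / real (Suc k)"
    have d: "0 < d" "0 < d / 2" "d / 2 < 1" by (simp_all add: d_def field_simps)
    have k: "0 < real (Suc k)" by simp
    have \<eta>2: "0 < \<eta> / 2" using \<open>\<eta> > 0\<close> by simp
    obtain K where K: "K \<ge> 1" and pert: "\<And>z l x. norm z \<le> 1 \<Longrightarrow> l \<ge> (1::nat) \<Longrightarrow>
        real (card {n\<in>{1..l}. norm ((T ^^ n) z) > K}) > (1 - d / 2) * real l \<Longrightarrow>
        \<exists>c. \<bar>c\<bar> \<le> \<eta> / 2 \<and> real (card {n\<in>{1..l}. norm ((T ^^ n) (x + c *\<^sub>R z)) > real (Suc k)}) > (1 - d) * real l"
      using perturbation_large_orbit[OF T \<eta>2 k d(1)] by blast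
    obtain R where R: "\<And>a N. a 0 \<le> 1 \<Longrightarrow> N \<ge> 1 \<Longrightarrow>
      real (card {n\<in>{1..N}. a n > R}) \<ge> \<epsilon> * real N \<Longrightarrow>
      \<exists>m l s. l \<ge> (1::nat) \<and> s \<ge> 1 \<and> a m \<le> s \<and>
        real (card {n\<in>{1..l}. a (m + n) > K * s}) > (1 - d / 2) * real l"
      using dense_excursion[OF \<open>\<epsilon> > 0\<close> d(2,3) K] by blast
    obtain y N where y: "y \<in> S" "norm y \<le> 1" "((\<lambda>n. norm ((T ^^ n) y)) \<longlongrightarrow> 0) ?F"
      and N: "N \<ge> 1" "real (card {n\<in>{1..N}. norm ((T ^^ n) y) > R}) \<ge> \<epsilon> * real N"
      using ex[of R] by blast
    obtain m l s where mls: "l \<ge> 1" "s \<ge> 1" "norm ((T ^^ m) y) \<le> s"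
      "real (card {n\<in>{1..l}. norm ((T ^^ (m + n)) y) > K * s}) > (1 - d / 2) * real l"
      using R[of "\<lambda>n. norm ((T ^^ n) y)", OF _ N] y(2) by auto
    \<comment> \<open>Restarting at time \<open>m\<close> and dividing by \<open>s\<close> makes the
      norm at most 1 and turns the level \<open>K * s\<close> into \<open>K\<close>. The summand 0
      gives the shape of \<open>Xadd\<close>.\<close>
    define z where "z = 0 + (1 / s) *\<^sub>R (T ^^ m) y"
    have "z \<in> X" unfolding z_def using y by (intro Xadd X0 XT) (simp add: X_def)
    have Tz: "norm ((T ^^ n) z) = norm ((T ^^ (m + n)) y) / s" for n
      using mls(2) by (simp add: z_def linear_scale[OF lin] funpow_add add.commute[of m n])
    have "norm z \<le> 1" using Tz[of 0] mls(2,3) by simp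
    moreover have "{n\<in>{1..l}. norm ((T ^^ (m + n)) y) > K * s} = {n\<in>{1..l}. norm ((T ^^ n) z) > K}"
      unfolding Tz using mls(2) by (auto simp: field_simps)
    ultimately obtain c where c: "\<bar>c\<bar> \<le> \<eta> / 2"
      "real (card {n\<in>{1..l}. norm ((T ^^ n) (x + c *\<^sub>R z)) > real (Suc k)}) > (1 - d) * real l"
      using pert[of z l x] mls(1,4) by auto
    have "x + c *\<^sub>R z \<in> X \<inter> U k"
      using Xadd[OF x \<open>z \<in> X\<close>] c(2) mls(1) unfolding U_def d_def by blast
    moreover have "dist (x + c *\<^sub>R z) x < \<eta>"
    proof -
      have "dist (x + c *\<^sub>R z) x = \<bar>c\<bar> * norm z" by (simp add: dist_norm)
      also have "\<dots> \<le> \<eta> / 2 * 1" using c(1) \<open>norm z \<le> 1\<close> by (intro mult_mono) auto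
      finally show ?thesis using \<open>\<eta> > 0\<close> by simp
    qed
    ultimately show "\<exists>y\<in>X \<inter> U k. dist y x < \<eta>" by blast
  qed
  have XY: "X \<subseteq> Y" unfolding Y_def by (rule closure_subset)
  have YS: "Y \<subseteq> S" unfolding Y_def using S(2) by (intro closure_minimal) (auto simp: X_def)
  \<comment> \<open>Both countable families are merged, so one use of Baire yields a vector in every
    \<open>V k\<close> and every \<open>U k\<close>.\<close>
  let ?G = "range (\<lambda>k. Y \<inter> V k) \<union> range (\<lambda>k. Y \<inter> U k)"
  have "top_of_set Y closure_of \<Inter>?G = topspace (top_of_set Y)"
  proof (rule Baire_category)
    show "completely_metrizable_space (top_of_set Y) \<or> locally_compact_space (top_of_set Y) \<and> regular_space (top_of_set Y)"
      using completely_metrizable_space_closed[OF comp, of Y] by (simp add: Y_def)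
    fix W assume "W \<in> ?G"
    then consider k where "W = Y \<inter> V k" | k where "W = Y \<inter> U k" by blast
    then obtain Q where Q: "W = Y \<inter> Q" "open Q" "X \<subseteq> closure (X \<inter> Q)"
    proof cases
      case 1
      have "X \<inter> V k = X" for k using XV by blast
      then show ?thesis using that[OF 1 openV] closure_subset[of X] by simp
    next
      case 2
      then show ?thesis using that[OF 2 openU XU] by simp
    qed
    \<comment> \<open>As \<open>X\<close> is dense in \<open>Y\<close>, it suffices that the closure
      of \<open>W\<close> contains \<open>X\<close>.\<close>
    have "closure (X \<inter> Q) \<subseteq> closure W" unfolding Q(1) using XY by (intro closure_mono) auto
    then have "Y \<subseteq> closure W" unfolding Y_def using Q(3) by (intro closure_minimal) auto
    moreover have "W \<subseteq> Y" using Q(1) by simp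
    ultimately have "top_of_set Y closure_of W = Y"
      by (simp add: closure_of_subtopology Int_absorb2 Int_absorb1)
    moreover have "openin (top_of_set Y) W" using Q(1,2) by (auto simp: openin_open)
    ultimately show "openin (top_of_set Y) W \<and> top_of_set Y closure_of W = topspace (top_of_set Y)"
      by simp
  qed auto
  moreover have "Y \<noteq> {}" using X0 XY by blast
  ultimately have "\<Inter>?G \<noteq> {}" by (intro notI) simp
  then obtain x where "x \<in> \<Inter>?G" by blast
  then have x: "x \<in> Y" "x \<in> V k" "x \<in> U k" for k by auto
  show ?thesis
  proof (rule distributionally_chaotic_on_if_irregular_vector[OF T S(1)])
    show "x \<in> S" using x(1) YS by blast
    fix t :: real assume "t > 0"
    show "upper_dens {n. 1 \<le> n \<and> norm ((T ^^ n) x) < t} = 1"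
      unfolding upper_dens_eq_1_iff frequently_sequentially int
    proof (intro allI impI)
      fix \<delta> :: real and j :: nat assume "\<delta> > 0"
      obtain k0 where k0: "inverse (real (Suc k0)) < min \<delta> t"
        using reals_Archimedean[of "min \<delta> t"] \<open>\<delta> > 0\<close> \<open>t > 0\<close> by auto
      define k where "k = max k0 j"
      have "1 / real (Suc k) \<le> 1 / real (Suc k0)" by (simp add: k_def field_simps)
      then have k: "1 / real (Suc k) < \<delta>" "1 / real (Suc k) < t" using k0 by (auto simp: inverse_eq_divide)
      obtain N where N: "N \<ge> k" "real (card {n\<in>{1..N}. norm ((T ^^ n) x) < 1 / real (Suc k)}) > (1 - 1 / real (Suc k)) * real N"
        using x(2)[of k] unfolding V_def by blast
      have "(1 - \<delta>) * real N \<le> (1 - 1 / real (Suc k)) * real N"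
        using k by (intro mult_right_mono) auto
      also note N(2)
      also have "real (card {n\<in>{1..N}. norm ((T ^^ n) x) < 1 / real (Suc k)}) \<le> real (card {n\<in>{1..N}. norm ((T ^^ n) x) < t})"
        using k by (intro of_nat_mono card_mono) auto
      finally show "\<exists>N\<ge>j. (1 - \<delta>) * real N < real (card {n\<in>{1..N}. norm ((T ^^ n) x) < t})"
        using N(1) by (intro exI[of _ N]) (auto simp: k_def)
    qed
  next
    fix R :: real assume "R > 0"
    show "lower_dens {n. 1 \<le> n \<and> norm ((T ^^ n) x) < R} = 0"
      unfolding lower_dens_eq_0_iff frequently_sequentially int
    proof (intro allI impI)
      fix \<delta> :: real and j :: nat assume "\<delta> > 0"
      \<comment> \<open>The orbit is bounded by \<open>M\<close> up to time \<open>j\<close>. Once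
        \<open>k + 1\<close> exceeds \<open>M\<close>, the length supplied by \<open>U k\<close>
        must reach beyond \<open>j\<close>.\<close>
      define M where "M = Max ((\<lambda>n. norm ((T ^^ n) x)) ` {..j})"
      have M: "norm ((T ^^ n) x) \<le> M" if "n \<le> j" for n
        unfolding M_def using that by (intro Max_ge) auto
      obtain k :: nat where k0: "real k > max (max R M) (inverse \<delta>)" using reals_Archimedean2 by blast
      have k: "R < real (Suc k)" "M < real (Suc k)" "1 / real (Suc k) \<le> \<delta>"
        using k0 \<open>\<delta> > 0\<close> by (auto simp: field_simps)
      obtain N where N: "N \<ge> 1" "real (card {n\<in>{1..N}. norm ((T ^^ n) x) > real (Suc k)}) > (1 - 1 / real (Suc k)) * real N"
        using x(3)[of k] unfolding U_def by blast
      have "(1 - 1 / real (Suc k)) * real N \<ge> 0" by simp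
      then have "{n\<in>{1..N}. norm ((T ^^ n) x) > real (Suc k)} \<noteq> {}"
        using N(2) by (metis card.empty not_le of_nat_0)
      then obtain n where "n \<le> N" "norm ((T ^^ n) x) > real (Suc k)" by auto
      then have "N \<ge> j" using M[of n] k(2) by linarith
      have "card {n\<in>{1..N}. norm ((T ^^ n) x) < R} + card {n\<in>{1..N}. norm ((T ^^ n) x) > real (Suc k)} =
          card ({n\<in>{1..N}. norm ((T ^^ n) x) < R} \<union> {n\<in>{1..N}. norm ((T ^^ n) x) > real (Suc k)})"
        using k(1) by (subst card_Un_disjoint) auto
      also have "\<dots> \<le> card {1..N}" by (intro card_mono) auto
      finally have "real (card {n\<in>{1..N}. norm ((T ^^ n) x) < R}) < 1 / real (Suc k) * real N"
        using N(2) by (simp add: algebra_simps)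
      also have "\<dots> \<le> \<delta> * real N" using k(3) by (intro mult_right_mono) auto
      finally show "\<exists>N\<ge>j. real (card {n\<in>{1..N}. norm ((T ^^ n) x) < R}) < \<delta> * real N"
        using \<open>N \<ge> j\<close> by blast
    qed
  qed
qed

subsection \<open>Weighted composition operators on \<open>C\<^sub>0\<close>\<close>

text \<open>Cauchy in the supremum metric means uniformly Cauchy, and uniform limits of bounded
  continuous functions are again bounded and continuous.\<close>

lemma complete_UNIV_bcontfun:
  "complete (UNIV :: ('a::topological_space \<Rightarrow>\<^sub>C 'b::complete_space) set)"
  unfolding complete_def
proof (intro allI impI)
  fix u :: "nat \<Rightarrow> 'a \<Rightarrow>\<^sub>C 'b"
  assume "(\<forall>n. u n \<in> UNIV) \<and> Cauchy u"
  then have "uniformly_Cauchy_on UNIV (\<lambda>n. apply_bcontfun (u n))"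
    unfolding uniformly_Cauchy_on_def Cauchy_def by (meson dist_fun_lt_imp_dist_val_lt)
  then obtain l where "uniform_limit UNIV (\<lambda>n. apply_bcontfun (u n)) l sequentially"
    using Cauchy_uniformly_convergent uniformly_convergent_on_def by blast
  then obtain l' where "(u \<longlongrightarrow> l') sequentially"
    by (rule uniform_limit_bcontfunE) simp
  then show "\<exists>l\<in>UNIV. u \<longlonglongrightarrow> l" by blast
qed

lemma C0D:
  assumes "\<phi> \<in> C0" "e > 0"
  obtains K where "compact K" "\<And>x. x \<notin> K \<Longrightarrow> norm (apply_bcontfun \<phi> x) < e"
  using assms unfolding C0_def vanishes_at_infinity_def by blast

lemma subspace_C0: "subspace (C0 :: ('a::topological_space \<Rightarrow>\<^sub>C 'k::real_normed_vector) set)"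
proof (rule subspaceI)
  show "(0 :: 'a \<Rightarrow>\<^sub>C 'k) \<in> C0"
    by (auto simp: C0_def vanishes_at_infinity_def)
next
  fix \<phi> \<psi> :: "'a \<Rightarrow>\<^sub>C 'k" assume \<phi>: "\<phi> \<in> C0" and \<psi>: "\<psi> \<in> C0"
  show "\<phi> + \<psi> \<in> C0"
    unfolding C0_def vanishes_at_infinity_def mem_Collect_eq
  proof (intro allI impI)
    fix e :: real assume "e > 0"
    then have e: "e / 2 > 0" by simp
    obtain K L where K: "compact K" "\<And>x. x \<notin> K \<Longrightarrow> norm (\<phi> x) < e / 2"
      and L: "compact L" "\<And>x. x \<notin> L \<Longrightarrow> norm (\<psi> x) < e / 2"
      using C0D[OF \<phi> e] C0D[OF \<psi> e] by metis
    have "norm ((\<phi> + \<psi>) x) < e" if "x \<notin> K \<union> L" for x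
      using norm_triangle_ineq[of "\<phi> x" "\<psi> x"] K(2)[of x] L(2)[of x] that by (simp add: plus_bcontfun.rep_eq)
    then show "\<exists>K. compact K \<and> (\<forall>x. x \<notin> K \<longrightarrow> norm ((\<phi> + \<psi>) x) < e)"
      using K(1) L(1) by (intro exI[of _ "K \<union> L"]) auto
  qed
next
  fix c :: real and \<phi> :: "'a \<Rightarrow>\<^sub>C 'k" assume \<phi>: "\<phi> \<in> C0"
  show "c *\<^sub>R \<phi> \<in> C0"
    unfolding C0_def vanishes_at_infinity_def mem_Collect_eq
  proof (intro allI impI)
    fix e :: real assume "e > 0"
    then have e: "e / (\<bar>c\<bar> + 1) > 0" by simp
    obtain K where K: "compact K" "\<And>x. x \<notin> K \<Longrightarrow> norm (\<phi> x) < e / (\<bar>c\<bar> + 1)"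
      using C0D[OF \<phi> e] by metis
    have "norm ((c *\<^sub>R \<phi>) x) < e" if "x \<notin> K" for x
    proof -
      have "(\<bar>c\<bar> + 1) * norm (\<phi> x) < e" using K(2)[OF that] by (simp add: field_simps)
      moreover have "\<bar>c\<bar> * norm (\<phi> x) \<le> (\<bar>c\<bar> + 1) * norm (\<phi> x)" by (intro mult_right_mono) auto
      ultimately show ?thesis by (simp add: scaleR_bcontfun.rep_eq)
    qed
    then show "\<exists>K. compact K \<and> (\<forall>x. x \<notin> K \<longrightarrow> norm ((c *\<^sub>R \<phi>) x) < e)"
      using K(1) by blast
  qed
qed

lemma closed_C0: "closed (C0 :: ('a::topological_space \<Rightarrow>\<^sub>C 'k::real_normed_vector) set)"
proof -
  have "\<phi> \<in> C0" if \<phi>: "\<phi> \<in> closure C0" for \<phi> :: "'a \<Rightarrow>\<^sub>C 'k"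
    unfolding C0_def vanishes_at_infinity_def mem_Collect_eq
  proof (intro allI impI)
    fix e :: real assume "e > 0"
    then have e: "e / 2 > 0" by simp
    then obtain \<psi> where \<psi>: "\<psi> \<in> C0" "dist \<psi> \<phi> < e / 2"
      using \<phi> unfolding closure_approachable by blast
    obtain K where K: "compact K" "\<And>x. x \<notin> K \<Longrightarrow> norm (\<psi> x) < e / 2"
      using C0D[OF \<psi>(1) e] by metis
    have "norm (\<phi> x) < e" if "x \<notin> K" for x
    proof -
      have "dist (\<psi> x) (\<phi> x) < e / 2" using \<psi>(2) by (rule dist_fun_lt_imp_dist_val_lt)
      then have "norm (\<phi> x - \<psi> x) < e / 2" by (simp add: dist_norm norm_minus_commute)
      then show ?thesis using K(2)[OF that] norm_triangle_sub[of "\<phi> x" "\<psi> x"] by linarith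
    qed
    then show "\<exists>K. compact K \<and> (\<forall>x. x \<notin> K \<longrightarrow> norm (\<phi> x) < e)" using K(1) by blast
  qed
  then show ?thesis using closure_subset_eq by blast
qed

text \<open>Outside some compact set the function stays below \<open>c\<close>; that set is closed
  by the Hausdorff property and so contains the closure as well. Such superlevel sets become the
  \<open>B i\<close> when chaos is given.\<close>

lemma C0_superlevel:
  fixes \<phi> :: "'a::t2_space \<Rightarrow>\<^sub>C 'k::real_normed_vector"
  assumes "\<phi> \<in> C0" "c > 0"
  shows "open {x. norm (\<phi> x) > c}" and "compact (closure {x. norm (\<phi> x) > c})"
proof -
  show "open {x. norm (\<phi> x) > c}"
    by (intro open_Collect_less continuous_on_norm continuous_on_const continuous_on_apply_bcontfun)
  obtain K where K: "compact K" "\<And>x. x \<notin> K \<Longrightarrow> norm (\<phi> x) < c"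
    using C0D[OF assms] by metis
  have "closure {x. norm (\<phi> x) > c} \<subseteq> K"
    using K by (intro closure_minimal compact_imp_closed) (auto intro: ccontr dest!: K(2))
  then show "compact (closure {x. norm (\<phi> x) > c})"
    using K(1) by (metis closed_closure compact_Int_closed inf.absorb_iff2)
qed

text \<open>Urysohn's lemma, available because a locally compact Hausdorff space is completely
  regular. Relative compactness of \<open>B\<close> makes the function vanish at infinity. The
  points of \<open>F\<close> will come from finitely many times.\<close>

lemma C0_bump:
  fixes B :: "'a::t2_space set"
  assumes lc: "locally_compact_space (euclidean :: 'a topology)"
    and B: "open B" "compact (closure B)" and F: "finite F" "F \<subseteq> B"
  obtains \<phi> :: "'a \<Rightarrow>\<^sub>C 'k::real_normed_algebra_1"
  where "\<phi> \<in> C0" "\<And>x. norm (\<phi> x) \<le> 1" "\<And>x. x \<in> F \<Longrightarrow> \<phi> x = 1" "\<And>x. x \<notin> B \<Longrightarrow> \<phi> x = 0"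
proof -
  have "Hausdorff_space (euclidean :: 'a topology)"
    unfolding Hausdorff_space_def disjnt_def by (simp add: separation_t2)
  then have "completely_regular_space (euclidean :: 'a topology)"
    using lc locally_compact_regular_imp_completely_regular_space by blast
  moreover have "closedin euclidean (- B)" using B(1) by (simp add: closed_Compl flip: closed_closedin)
  moreover have "compactin euclidean F" using F(1) by (simp add: finite_imp_compact)
  moreover have "disjnt (- B) F" using F(2) by (auto simp: disjnt_def)
  \<comment> \<open>The compact set \<open>F\<close> receives the smaller endpoint, so
    \<open>g\<close> runs from -1 on \<open>F\<close> to 0 off \<open>B\<close>, and its negative is
    the bump.\<close>
  ultimately obtain g where g: "continuous_map euclidean (subtopology euclidean {-1..0::real}) g"
    "g ` F \<subseteq> {-1}" "g ` (- B) \<subseteq> {0}"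
    using Urysohn_completely_regular_closed_compact[of "-1" 0 euclidean "- B" F] by auto
  then have cont: "continuous_on UNIV g" and rng: "g x \<in> {-1..0}" for x
    by (auto simp: continuous_map_in_subtopology)
  define h :: "'a \<Rightarrow> 'k" where "h = (\<lambda>x. of_real (- g x))"
  have h: "continuous_on UNIV h" unfolding h_def by (intro continuous_intros cont)
  have h0: "h x = 0" if "x \<notin> B" for x using that g(3) by (simp add: h_def image_subset_iff)
  then have "h x = 0" if "x \<notin> closure B" for x using that closure_subset by blast
  then have "vanishes_at_infinity h"
    unfolding vanishes_at_infinity_def using B(2) by (intro allI impI exI[of _ "closure B"]) simp
  note hC0 = C0I[OF h this]
  have "h x = 1" if "x \<in> F" for x using that g(2) by (simp add: h_def image_subset_iff)
  moreover have "norm (h x) \<le> 1" for x using rng[of x] by (simp add: h_def)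
  ultimately show ?thesis
    using h0 that[of "Bcontfun h"] hC0 by simp
qed

section \<open>Estimates for suprema over a set\<close>

text \<open>Nonnegativity of \<open>c\<close> covers the empty set, where the value is 0 by
  definition.\<close>

lemma supnorm_on_le:
  assumes "c \<ge> 0" "\<And>x. x \<in> B \<Longrightarrow> norm (\<phi> x) \<le> c"
  shows "supnorm_on B \<phi> \<le> c"
  using assms unfolding supnorm_on_def by (auto intro: cSUP_least)

text \<open>The bound \<open>c\<close> makes the set of norms bounded above, so that the real
  supremum is a genuine one.\<close>

lemma norm_le_supnorm_on:
  assumes "x \<in> B" "\<And>x. x \<in> B \<Longrightarrow> norm (\<phi> x) \<le> c"
  shows "norm (\<phi> x) \<le> supnorm_on B \<phi>"
  using assms unfolding supnorm_on_def by (auto intro!: cSUP_upper bdd_aboveI2)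

lemma supnorm_on_nonneg:
  assumes "\<And>x. x \<in> B \<Longrightarrow> norm (\<phi> x) \<le> c"
  shows "supnorm_on B \<phi> \<ge> 0"
proof (cases "B = {}")
  case False
  then obtain x where "x \<in> B" by blast
  then have "norm (\<phi> x) \<le> supnorm_on B \<phi>" using assms by (rule norm_le_supnorm_on)
  then show ?thesis by (rule order_trans[OF norm_ge_zero])
qed (simp add: supnorm_on_def)

lemma less_supnorm_onD:
  assumes "c \<ge> 0" "c < supnorm_on B \<phi>"
  shows "\<exists>x\<in>B. c < norm (\<phi> x)"
  using supnorm_on_le[OF assms(1), of B \<phi>] assms(2) by (meson not_less)

section \<open>Iterates of the weighted composition operator and the two implications\<close>

locale weighted_composition =
  fixes w :: "'a::t2_space \<Rightarrow> 'k::{real_normed_field, euclidean_space}" and f :: "'a \<Rightarrow> 'a"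
  assumes w: "continuous_on UNIV w" "bounded (range w)" and f: "continuous_on UNIV f"
    and proper: "\<forall>e>0. \<forall>K. compact K \<longrightarrow> compact {x. f x \<in> K \<and> norm (w x) \<ge> e}"
begin

abbreviation T :: "('a \<Rightarrow>\<^sub>C 'k) \<Rightarrow> ('a \<Rightarrow>\<^sub>C 'k)"
  where "T \<equiv> weighted_comp w f"

abbreviation weight_norm :: "nat \<Rightarrow> 'a set \<Rightarrow> real"
  where "weight_norm n B \<equiv> supnorm_on ((f ^^ n) -` B) (weight_prod w f n)"

text \<open>Taking \<open>C \<ge> 1\<close> makes \<open>C ^ n\<close> increasing in
  \<open>n\<close>, so one power bounds all weights up to a given time.\<close>

lemma weight_bound: obtains C where "C \<ge> 1" "\<And>x. norm (w x) \<le> C"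
proof -
  obtain M where "\<And>x. norm (w x) \<le> M" using w(2) by (auto simp: bounded_iff)
  then show ?thesis using that[of "max M 1"] by (simp add: le_max_iff_disj)
qed

lemma norm_weight_prod_le:
  assumes "\<And>x. norm (w x) \<le> C"
  shows "norm (weight_prod w f n x) \<le> C ^ n"
proof -
  have "norm (weight_prod w f n x) = (\<Prod>j<n. norm (w ((f ^^ j) x)))"
    by (simp add: weight_prod_def prod_norm)
  also have "\<dots> \<le> (\<Prod>j<n. C)" using assms by (intro prod_mono) auto
  finally show ?thesis by simp
qed

lemma norm_weight_prod_le_weight_norm:
  "(f ^^ n) x \<in> B \<Longrightarrow> norm (weight_prod w f n x) \<le> weight_norm n B"
  using weight_bound norm_weight_prod_le by (metis norm_le_supnorm_on vimageI)

lemma weight_norm_nonneg: "weight_norm n B \<ge> 0"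
  using weight_bound norm_weight_prod_le by (metis supnorm_on_nonneg)

lemma bounded_linear_T: "bounded_linear T"
proof -
  obtain C where C: "C \<ge> 1" "\<And>x. norm (w x) \<le> C" by (rule weight_bound) blast
  show ?thesis
  proof (rule bounded_linear_intro)
    fix \<phi> :: "'a \<Rightarrow>\<^sub>C 'k"
    show "norm (T \<phi>) \<le> norm \<phi> * C"
    proof (rule norm_bound)
      fix x
      show "norm (T \<phi> x) \<le> norm \<phi> * C"
        unfolding apply_weighted_comp[OF w f] norm_mult by (intro mult_mono norm_bounded C) auto
    qed
  qed (auto intro!: bcontfun_eqI simp: apply_weighted_comp[OF w f] plus_bcontfun.rep_eq
      scaleR_bcontfun.rep_eq algebra_simps)
qed

lemma T_C0: "T ` C0 \<subseteq> C0"
  using weighted_comp_C0[OF w f proper] by blast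

lemma T_funpow_C0: "\<phi> \<in> C0 \<Longrightarrow> (T ^^ n) \<phi> \<in> C0"
  using T_C0 by (induction n) auto

lemma apply_T_funpow: "(T ^^ n) \<phi> x = \<phi> ((f ^^ n) x) * weight_prod w f n x"
proof (induction n arbitrary: x)
  case (Suc n)
  \<comment> \<open>The factor with index 0 is split off: the outermost \<open>T\<close> contributes
    \<open>w x\<close>, and the induction hypothesis is used at \<open>f x\<close>.\<close>
  have "weight_prod w f (Suc n) x = w x * weight_prod w f n (f x)"
    by (simp add: weight_prod_def prod.lessThan_Suc_shift funpow_swap1 del: prod.lessThan_Suc)
  moreover have "(T ^^ Suc n) \<phi> x = (T ^^ n) \<phi> (f x) * w x"
    by (simp add: apply_weighted_comp[OF w f])
  ultimately show ?case by (simp add: Suc funpow_Suc_right del: funpow.simps)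
qed (simp add: weight_prod_def)

text \<open>For each large time \<open>n\<close> pick \<open>x n\<close> with
  \<open>(f ^^ n) (x n)\<close> in \<open>B i\<close> and a weight above \<open>k\<close>. A bump
  that is 1 at these finitely many image points and 0 off \<open>B i\<close> has a large orbit at
  those times, while \<open>weight_norm n (B i)\<close> dominates the whole orbit and tends to 0
  along \<open>D\<close>.\<close>

lemma chaotic_if_weight_conditions:
  assumes lc: "locally_compact_space (euclidean :: 'a topology)"
    and B: "\<And>i::nat. open (B i)" "\<And>i. compact (closure (B i))"
    and D: "upper_dens D = 1" "\<And>i. ((\<lambda>n. weight_norm n (B i)) \<longlongrightarrow> 0) (inf sequentially (principal D))"
    and "\<epsilon> > 0"
    and N: "\<And>k::nat. k \<ge> 1 \<Longrightarrow> N k \<ge> 1"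
      "\<And>k. k \<ge> 1 \<Longrightarrow> \<exists>i. real (card {n\<in>{1..N k}. weight_norm n (B i) > real k}) \<ge> \<epsilon> * real (N k)"
  shows "distributionally_chaotic_on C0 T"
proof (rule distributionally_chaotic_onI[OF bounded_linear_T complete_UNIV_bcontfun subspace_C0 closed_C0 T_C0 D(1) \<open>\<epsilon> > 0\<close>])
  fix R :: real
  \<comment> \<open>An index at least \<open>R\<close>, raised to at least 1 because the hypotheses
    on \<open>N\<close> start there.\<close>
  define k where "k = nat \<lceil>max R 1\<rceil>"
  have k: "k \<ge> 1" "real k \<ge> R" unfolding k_def by linarith+
  obtain i where i: "real (card {n\<in>{1..N k}. weight_norm n (B i) > real k}) \<ge> \<epsilon> * real (N k)"
    using N(2)[OF k(1)] by blast
  define G where "G = {n\<in>{1..N k}. weight_norm n (B i) > real k}"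
  have "\<exists>x. (f ^^ n) x \<in> B i \<and> real k < norm (weight_prod w f n x)" if "n \<in> G" for n
    using less_supnorm_onD[of "real k" "(f ^^ n) -` B i" "weight_prod w f n"] that by (auto simp: G_def)
  then obtain x where x: "\<And>n. n \<in> G \<Longrightarrow> (f ^^ n) (x n) \<in> B i"
    "\<And>n. n \<in> G \<Longrightarrow> real k < norm (weight_prod w f n (x n))" by metis
  define F where "F = (\<lambda>n. (f ^^ n) (x n)) ` G"
  have "finite F" "F \<subseteq> B i" using x(1) by (auto simp: F_def G_def)
  then obtain \<phi> :: "'a \<Rightarrow>\<^sub>C 'k" where \<phi>: "\<phi> \<in> C0" "\<And>x. norm (\<phi> x) \<le> 1"
    "\<And>x. x \<in> F \<Longrightarrow> \<phi> x = 1" "\<And>x. x \<notin> B i \<Longrightarrow> \<phi> x = 0"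
    using C0_bump[OF lc B] by metis
  have upper: "norm ((T ^^ n) \<phi>) \<le> weight_norm n (B i)" for n
  proof (rule norm_bound)
    fix z
    show "norm ((T ^^ n) \<phi> z) \<le> weight_norm n (B i)"
    proof (cases "(f ^^ n) z \<in> B i")
      case True
      have "norm ((T ^^ n) \<phi> z) \<le> 1 * norm (weight_prod w f n z)"
        unfolding apply_T_funpow norm_mult by (intro mult_right_mono \<phi>) auto
      also have "\<dots> \<le> weight_norm n (B i)" using norm_weight_prod_le_weight_norm[OF True] by simp
      finally show ?thesis .
    next
      case False
      then show ?thesis using \<phi>(4) weight_norm_nonneg by (simp add: apply_T_funpow)
    qed
  qed
  have lower: "norm ((T ^^ n) \<phi>) > R" if "n \<in> G" for n
  proof -
    have "norm ((T ^^ n) \<phi> (x n)) = norm (weight_prod w f n (x n))"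
      using \<phi>(3) that by (simp add: apply_T_funpow F_def)
    then show ?thesis using x(2)[OF that] k(2) norm_bounded[of "(T ^^ n) \<phi>" "x n"] by linarith
  qed
  have "\<epsilon> * real (N k) \<le> real (card G)" using i by (simp add: G_def)
  also have "card G \<le> card {n\<in>{1..N k}. norm ((T ^^ n) \<phi>) > R}"
    using lower by (intro card_mono) (auto simp: G_def)
  finally have "\<epsilon> * real (N k) \<le> real (card {n\<in>{1..N k}. norm ((T ^^ n) \<phi>) > R})" by simp
  moreover have "((\<lambda>n. norm ((T ^^ n) \<phi>)) \<longlongrightarrow> 0) (inf sequentially (principal D))"
    by (rule tendsto_norm_zero_dominated[OF D(2)[of i] upper])
  moreover have "norm \<phi> \<le> 1" using \<phi>(2) by (rule norm_bound)
  ultimately show "\<exists>y\<in>C0. norm y \<le> 1 \<and> ((\<lambda>n. norm ((T ^^ n) y)) \<longlongrightarrow> 0) (inf sequentially (principal D)) \<and>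
      (\<exists>N\<ge>1. real (card {n\<in>{1..N}. norm ((T ^^ n) y) > R}) \<ge> \<epsilon> * real N)"
    using \<phi>(1) N(1)[OF k(1)] by (intro bexI[of _ \<phi>] conjI exI[of _ "N k"]) simp_all
qed

text \<open>Each \<open>k\<close> uses one pair \<open>(j, m)\<close>: \<open>j\<close> makes the
  iterate so small that only weights above \<open>k\<close> can bring its orbit back to size
  \<open>e / 2\<close>, and \<open>m\<close> makes the superlevel set catch all the points where
  this happens up to time \<open>N\<close>.\<close>

lemma weight_conditions_if_chaotic:
  assumes "distributionally_chaotic_on C0 T"
  obtains B :: "nat \<Rightarrow> 'a set" and D and N :: "nat \<Rightarrow> nat"
  where "\<And>i. open (B i)" "\<And>i. compact (closure (B i))"
    "D \<subseteq> {1..}" "upper_dens D = 1"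
    "\<And>i. ((\<lambda>n. weight_norm n (B i)) \<longlongrightarrow> 0) (inf sequentially (principal D))"
    "strict_mono N" "\<And>k. N k > 0"
    "\<And>k. \<exists>i. real (card {n\<in>{1..N k}. weight_norm n (B i) > real k}) \<ge> 1 / 2 * real (N k)"
proof -
  obtain \<Gamma> e where *: "\<Gamma> \<subseteq> C0 \<and> uncountable \<Gamma> \<and> e > 0 \<and>
      (\<forall>x\<in>\<Gamma>. \<forall>y\<in>\<Gamma>. x \<noteq> y \<longrightarrow>
        lower_dens {n. 1 \<le> n \<and> dist ((T ^^ n) x) ((T ^^ n) y) < e} = 0 \<and>
        (\<forall>t>0. upper_dens {n. 1 \<le> n \<and> dist ((T ^^ n) x) ((T ^^ n) y) < t} = 1))"
    using assms unfolding distributionally_chaotic_on_def by (elim exE) (rule that)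
  then have \<Gamma>: "\<Gamma> \<subseteq> C0" "uncountable \<Gamma>" and e: "e > 0" by simp_all
  have "\<exists>x y. x \<in> \<Gamma> \<and> y \<in> \<Gamma> \<and> x \<noteq> y"
  proof (rule ccontr)
    assume single: "\<nexists>x y. x \<in> \<Gamma> \<and> y \<in> \<Gamma> \<and> x \<noteq> y"
    obtain x where "x \<in> \<Gamma>" using \<Gamma>(2) by fastforce
    then have "\<Gamma> = {x}" using single by blast
    then show False using \<Gamma>(2) by simp
  qed
  then obtain x y where xy: "x \<in> \<Gamma>" "y \<in> \<Gamma>" "x \<noteq> y" by blast
  define \<phi> where "\<phi> = x - y"
  have "dist ((T ^^ n) x) ((T ^^ n) y) = norm ((T ^^ n) \<phi>)" for n
    using bounded_linear.linear[OF bounded_linear_funpow[OF bounded_linear_T, of n]]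
    by (simp add: \<phi>_def dist_norm linear_diff)
  then have low: "lower_dens {n. 1 \<le> n \<and> norm ((T ^^ n) \<phi>) < e} = 0"
    and up: "\<And>t. t > 0 \<Longrightarrow> upper_dens {n. 1 \<le> n \<and> norm ((T ^^ n) \<phi>) < t} = 1"
    using *[THEN conjunct2, THEN conjunct2, THEN conjunct2, rule_format, OF xy] by simp_all
  have \<phi>C0: "\<phi> \<in> C0" using xy \<Gamma>(1) subspace_C0 by (auto simp: \<phi>_def intro: subspace_diff)
  obtain D where D: "D \<subseteq> {1..}" "upper_dens D = 1"
    "((\<lambda>n. norm ((T ^^ n) \<phi>)) \<longlongrightarrow> 0) (inf sequentially (principal D))"
    by (rule upper_dens_1_obtain_tendsto_0[OF norm_ge_zero up])
  \<comment> \<open>Every iterate is included because the smallness required of it depends on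
    \<open>k\<close>; pairs keep the family countable.\<close>
  define S where "S = (\<lambda>(j, m). {x. norm ((T ^^ j) \<phi> x) > 1 / real (Suc m)})"
  have S: "open (S p)" "compact (closure (S p))" for p
    using C0_superlevel[OF T_funpow_C0[OF \<phi>C0]] by (simp_all add: S_def split: prod.split)
  have weight_S: "((\<lambda>n. weight_norm n (S (j, m))) \<longlongrightarrow> 0) (inf sequentially (principal D))" for j m
  proof -
    obtain C where C: "C \<ge> 0" "\<And>v. norm ((T ^^ j) v) \<le> norm v * C"
      using bounded_linear.nonneg_bounded[OF bounded_linear_funpow[OF bounded_linear_T]] by blast
    \<comment> \<open>On the preimage of \<open>S (j, m)\<close> the factor coming from the
      \<open>j\<close>-th iterate exceeds \<open>1 / (m + 1)\<close>, so it can be divided out.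
      Iterates commute, so the bound \<open>C\<close> of \<open>T ^^ j\<close> leads back to the
      orbit of \<open>\<phi>\<close>.\<close>
    have le: "weight_norm n (S (j, m)) \<le> real (Suc m) * (norm ((T ^^ n) \<phi>) * C)" for n
    proof -
      have commute: "(T ^^ n) ((T ^^ j) \<phi>) = (T ^^ j) ((T ^^ n) \<phi>)"
        by (metis add.commute comp_apply funpow_add)
      have orbit: "norm ((T ^^ n) ((T ^^ j) \<phi>)) \<le> norm ((T ^^ n) \<phi>) * C"
        unfolding commute by (rule C(2))
      show ?thesis
      proof (rule supnorm_on_le)
        show "0 \<le> real (Suc m) * (norm ((T ^^ n) \<phi>) * C)"
          using C(1) by simp
        fix z assume "z \<in> (f ^^ n) -` S (j, m)"
        then have "1 / real (Suc m) * norm (weight_prod w f n z) \<le>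
            norm ((T ^^ j) \<phi> ((f ^^ n) z)) * norm (weight_prod w f n z)"
          by (intro mult_right_mono) (auto simp: S_def)
        also have "\<dots> = norm ((T ^^ n) ((T ^^ j) \<phi>) z)"
          by (simp add: apply_T_funpow[of n] norm_mult)
        also have "\<dots> \<le> norm ((T ^^ n) \<phi>) * C"
          by (rule order_trans[OF norm_bounded orbit])
        finally show "norm (weight_prod w f n z) \<le> real (Suc m) * (norm ((T ^^ n) \<phi>) * C)"
          by (simp add: field_simps)
      qed
    qed
    have "((\<lambda>n. real (Suc m) * (norm ((T ^^ n) \<phi>) * C)) \<longlongrightarrow> real (Suc m) * (0 * C)) (inf sequentially (principal D))"
      by (intro tendsto_intros D)
    then have "((\<lambda>n. norm (weight_norm n (S (j, m)))) \<longlongrightarrow> 0) (inf sequentially (principal D))"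
      using le weight_norm_nonneg by (intro tendsto_norm_zero_dominated) simp_all
    then show ?thesis by (rule tendsto_norm_zero_cancel)
  qed
  obtain C where C: "C \<ge> 1" "\<And>x. norm (w x) \<le> C" by (rule weight_bound) blast
  define P where "P k N \<longleftrightarrow> (\<exists>p. real (card {n\<in>{1..N}. weight_norm n (S p) > real k}) \<ge> 1 / 2 * real N)"
    for k N :: nat
  have large: "\<exists>N>M. P k N" for M k :: nat
  proof -
    define c where "c = real k + 1"
    have c: "c > 0" "c \<ge> real k" by (simp_all add: c_def)
    have "upper_dens {n. 1 \<le> n \<and> norm ((T ^^ n) \<phi>) < e / (2 * c)} = 1"
      using e c by (intro up) simp
    \<comment> \<open>With \<open>\<delta> = 1\<close> the density criterion just yields nonempty
      counts, hence a time \<open>j\<close> at which the orbit is small.\<close>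
    then have "\<exists>\<^sub>F N in sequentially. real (card ({n. 1 \<le> n \<and> norm ((T ^^ n) \<phi>) < e / (2 * c)} \<inter> {1..N})) > (1 - 1) * real N"
      unfolding upper_dens_eq_1_iff using zero_less_one by blast
    then obtain N0 where "card ({n. 1 \<le> n \<and> norm ((T ^^ n) \<phi>) < e / (2 * c)} \<inter> {1..N0}) > 0"
      by (auto dest: frequently_ex)
    then obtain j where j: "norm ((T ^^ j) \<phi>) < e / (2 * c)"
      unfolding card_gt_0_iff by blast
    define Low where "Low = {n. 1 \<le> n \<and> norm ((T ^^ n) \<phi>) < e}"
    have "\<exists>\<^sub>F N in sequentially. real (card (Low \<inter> {1..N})) < 1 / 4 * real N"
      unfolding Low_def by (rule low[unfolded lower_dens_eq_0_iff, rule_format]) simp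
    \<comment> \<open>The lower bound on \<open>N'\<close> gives \<open>N' - j > M\<close> and
      \<open>N' \<le> 2 * (N' - j)\<close>, so a quarter of \<open>N'\<close> is at most half of the
      shortened length.\<close>
    then obtain N' where N': "N' \<ge> 2 * j + M + 1" "real (card (Low \<inter> {1..N'})) < 1 / 4 * real N'"
      unfolding frequently_sequentially by blast
    define N where "N = N' - j"
    have N: "N > M" "N' = N + j" "real N' \<le> 2 * real N" using N'(1) by (auto simp: N_def)
    define Q where "Q = {n\<in>{1..N}. norm ((T ^^ n) ((T ^^ j) \<phi>)) < e}"
    \<comment> \<open>Shifting by \<open>j\<close> carries small times of the iterate to small times
      of \<open>\<phi>\<close>.\<close>
    have "(\<lambda>n. n + j) ` Q \<subseteq> Low \<inter> {1..N'}"
      using N(2) by (auto simp: Q_def Low_def funpow_add)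
    then have "card Q \<le> card (Low \<inter> {1..N'})"
      by (metis card_image card_mono finite_Int finite_atLeastAtMost inj_on_add')
    then have Q: "real (card Q) \<le> 1 / 2 * real N" using N'(2) N(3) by linarith
    have "e / (2 * C ^ N) > 0" using e C(1) by simp
    \<comment> \<open>Weights up to time \<open>N\<close> are at most \<open>C ^ N\<close>, so a
      product above \<open>e / 2\<close> forces the iterate above \<open>e / (2 * C ^ N)\<close> at
      \<open>(f ^^ n) z\<close>, hence above the level \<open>1 / (m + 1)\<close>.\<close>
    then obtain m where m: "inverse (real (Suc m)) < e / (2 * C ^ N)" using reals_Archimedean by blast
    have "weight_norm n (S (j, m)) > real k" if n: "n \<in> {1..N} - Q" for n
    proof -
      \<comment> \<open>Passing from \<open>e\<close> to \<open>e / 2\<close> yields a point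
        \<open>z\<close> with a strict inequality even if the norm is not attained.\<close>
      have "\<not> norm ((T ^^ n) ((T ^^ j) \<phi>)) \<le> e / 2" using n e by (auto simp: Q_def)
      then obtain z where "\<not> norm ((T ^^ n) ((T ^^ j) \<phi>) z) \<le> e / 2" using norm_bound by blast
      then have z: "norm ((T ^^ j) \<phi> ((f ^^ n) z)) * norm (weight_prod w f n z) > e / 2"
        by (simp add: apply_T_funpow[of n] norm_mult)
      have "norm (weight_prod w f n z) \<le> C ^ n" by (rule norm_weight_prod_le[OF C(2)])
      also have "\<dots> \<le> C ^ N" using n C(1) by (intro power_increasing) auto
      finally have "norm ((T ^^ j) \<phi> ((f ^^ n) z)) * norm (weight_prod w f n z) \<le> norm ((T ^^ j) \<phi> ((f ^^ n) z)) * C ^ N"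
        by (intro mult_left_mono) auto
      then have "e / 2 < norm ((T ^^ j) \<phi> ((f ^^ n) z)) * C ^ N" using z by linarith
      then have "e / (2 * C ^ N) < norm ((T ^^ j) \<phi> ((f ^^ n) z))"
        using C(1) by (simp add: field_simps)
      then have "(f ^^ n) z \<in> S (j, m)" using m by (simp add: S_def inverse_eq_divide)
      then have "norm (weight_prod w f n z) \<le> weight_norm n (S (j, m))"
        by (rule norm_weight_prod_le_weight_norm)
      \<comment> \<open>Conversely, the iterate is nowhere above \<open>e / (2 * c)\<close>, so the
        weight must supply a factor larger than \<open>c\<close>.\<close>
      moreover have "c < norm (weight_prod w f n z)"
      proof -
        have "norm ((T ^^ j) \<phi> ((f ^^ n) z)) \<le> e / (2 * c)"
          using j norm_bounded[of "(T ^^ j) \<phi>" "(f ^^ n) z"] by linarith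
        then have "norm ((T ^^ j) \<phi> ((f ^^ n) z)) * norm (weight_prod w f n z) \<le> e / (2 * c) * norm (weight_prod w f n z)"
          by (intro mult_right_mono) auto
        then have "e / 2 < e / (2 * c) * norm (weight_prod w f n z)" using z by linarith
        then show ?thesis using e c(1) by (simp add: field_simps)
      qed
      ultimately show ?thesis using c(2) by linarith
    qed
    then have "card ({1..N} - Q) \<le> card {n\<in>{1..N}. weight_norm n (S (j, m)) > real k}"
      by (intro card_mono) auto
    moreover have "card ({1..N} - Q) = N - card Q" "card Q \<le> N"
    proof -
      have "Q \<subseteq> {1..N}" by (auto simp: Q_def)
      then show "card ({1..N} - Q) = N - card Q" "card Q \<le> N"
        using card_Diff_subset[of Q "{1..N}"] card_mono[of "{1..N}" Q] by (auto intro: finite_subset)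
    qed
    ultimately have "real (card {n\<in>{1..N}. weight_norm n (S (j, m)) > real k}) \<ge> 1 / 2 * real N"
      using Q by linarith
    then have "P k N" unfolding P_def by (rule exI)
    then show ?thesis using N(1) by (intro exI[of _ N] conjI)
  qed
  have "\<exists>N. \<forall>k. (N k > 0 \<and> P k (N k)) \<and> N k < N (Suc k)"
  proof (rule dependent_nat_choice)
    show "\<exists>N. N > 0 \<and> P 0 N" using large[of 0 0] by blast
    show "\<exists>N. (N > 0 \<and> P (Suc k) N) \<and> M < N" for M k
      using large[of M "Suc k"] gr_implies_not0 by blast
  qed
  then obtain N where N: "\<And>k. N k > 0" "\<And>k. N k < N (Suc k)" and big: "\<And>k. P k (N k)"
    by blast
  show ?thesis
  \<comment> \<open>Pairing turns the family indexed by \<open>(j, m)\<close> into a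
    sequence.\<close>
  proof (rule that[of "S \<circ> prod_decode" D N])
    show "strict_mono N" using N(2) by (simp add: strict_mono_Suc_iff)
    fix i k
    show "((\<lambda>n. weight_norm n ((S \<circ> prod_decode) i)) \<longlongrightarrow> 0) (inf sequentially (principal D))"
      using weight_S by (cases "prod_decode i") simp
    obtain p where "real (card {n\<in>{1..N k}. weight_norm n (S p) > real k}) \<ge> 1 / 2 * real (N k)"
      using big[of k] unfolding P_def by (rule exE)
    then show "\<exists>i. real (card {n\<in>{1..N k}. weight_norm n ((S \<circ> prod_decode) i) > real k}) \<ge> 1 / 2 * real (N k)"
      by (intro exI[of _ "prod_encode p"]) simp
  qed (use S D N(1) in auto)
qed

end

text \<open>Indexing \<open>B\<close> from 0 is only a relabelling, whereas \<open>k\<close> is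
  compared with the weights and therefore starts at 1. The limit along \<open>D\<close> is a limit
  along the filter \<open>inf sequentially (principal D)\<close>, which is proper since a set of
  upper density 1 is infinite.\<close>

theorem theorem42:
  fixes w :: "'a::t2_space \<Rightarrow> 'k::{real_normed_field, euclidean_space}"
    and f :: "'a \<Rightarrow> 'a"
  assumes "locally_compact_space (euclidean :: 'a topology)"
    and "continuous_on UNIV w" and "bounded (range w)"
    and "continuous_on UNIV f"
    and "\<forall>e>0. \<forall>K. compact K \<longrightarrow> compact {x. f x \<in> K \<and> norm (w x) \<ge> e}"
  shows "distributionally_chaotic_on (C0 :: ('a \<Rightarrow>\<^sub>C 'k) set) (weighted_comp w f) \<longleftrightarrow>
    (\<exists>B :: nat \<Rightarrow> 'a set.
      (\<forall>i. open (B i) \<and> compact (closure (B i))) \<and>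
      (\<exists>D. D \<subseteq> {1..} \<and> upper_dens D = 1 \<and>
        (\<forall>i. ((\<lambda>n. supnorm_on ((f ^^ n) -` B i) (weight_prod w f n)) \<longlongrightarrow> 0)
               (inf sequentially (principal D)))) \<and>
      (\<exists>e>0. \<exists>N :: nat \<Rightarrow> nat. strict_mono_on {1..} N \<and> (\<forall>k\<ge>1. N k > 0) \<and>
        (\<forall>k\<ge>1. \<exists>i.
          real (card {n\<in>{1..N k}. supnorm_on ((f ^^ n) -` B i) (weight_prod w f n) > real k})
            \<ge> e * real (N k))))"
  (is "?chaos \<longleftrightarrow> ?weights")
proof -
  interpret weighted_composition w f using assms(2-5) by unfold_locales
  show ?thesis
  proof
    assume ?chaos
    then show ?weights
    proof (rule weight_conditions_if_chaotic)
      fix B :: "nat \<Rightarrow> 'a set" and D and N :: "nat \<Rightarrow> nat"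
      assume B: "\<And>i. open (B i)" "\<And>i. compact (closure (B i))"
        and D: "D \<subseteq> {1..}" "upper_dens D = 1"
          "\<And>i. ((\<lambda>n. weight_norm n (B i)) \<longlongrightarrow> 0) (inf sequentially (principal D))"
        and N: "strict_mono N" "\<And>k. N k > 0"
          "\<And>k. \<exists>i. real (card {n\<in>{1..N k}. weight_norm n (B i) > real k}) \<ge> 1 / 2 * real (N k)"
      have N': "strict_mono_on {1..} N" using N(1) by (intro strict_mono_onI) (rule strict_monoD)
      show ?weights
      proof (rule exI[of _ B], intro conjI)
        show "\<forall>i. open (B i) \<and> compact (closure (B i))" using B by simp
        show "\<exists>D. D \<subseteq> {1..} \<and> upper_dens D = 1 \<and>
            (\<forall>i. ((\<lambda>n. weight_norm n (B i)) \<longlongrightarrow> 0) (inf sequentially (principal D)))"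
          using D by (intro exI[of _ D]) simp
        show "\<exists>e>0. \<exists>N :: nat \<Rightarrow> nat. strict_mono_on {1..} N \<and> (\<forall>k\<ge>1. N k > 0) \<and>
            (\<forall>k\<ge>1. \<exists>i. real (card {n\<in>{1..N k}. weight_norm n (B i) > real k}) \<ge> e * real (N k))"
          by (rule exI[of _ "1 / 2"], rule conjI, simp, rule exI[of _ N], intro conjI allI impI N' N(2,3))
      qed
    qed
  next
    assume ?weights
    then show ?chaos
    proof (elim exE conjE)
      fix B :: "nat \<Rightarrow> 'a set" and D e and N :: "nat \<Rightarrow> nat"
      assume B: "\<forall>i. open (B i) \<and> compact (closure (B i))"
        and D: "upper_dens D = 1"
          "\<forall>i. ((\<lambda>n. weight_norm n (B i)) \<longlongrightarrow> 0) (inf sequentially (principal D))"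
        and N: "e > 0" "\<forall>k\<ge>1. N k > 0"
          "\<forall>k\<ge>1. \<exists>i. real (card {n\<in>{1..N k}. weight_norm n (B i) > real k}) \<ge> e * real (N k)"
      have "N k \<ge> 1" if "k \<ge> 1" for k using N(2) that by (simp add: Suc_le_eq)
      then show ?chaos
        using B D N(1,3) by (intro chaotic_if_weight_conditions[OF assms(1), of B D e N]) simp_all
    qed
  qed
qed

end
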